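(* Let $\lambda=(\lambda_k)_{k\in\mathbb{Z}}$, $\beta=(\beta_k)_{k\in\mathbb{Z}}$ be sequences with nonzero components such that $\varphi_\lambda,\varphi_\beta\in L_2(\mathbb{T})$. For $m\in\mathbb{N}$ put $$\varepsilon_m=\max\Big\{\sup_{|k|>m}|\lambda_k^{-1}|,\ \sqrt{\sum_{j\in\mathbb{Z},\,j\neq 0}\Gamma_{m,j}^2}\Big\},$$ where $\gamma_k=\alpha_{k'}\beta_k^{-1}$, $k'$ is the unique integer in $[-m,m]$ such that $(k-k')/(2m+1)$ is an integer, and $\Gamma_{m,j}=\max\{|\gamma_k|:k\in I_{m,j}\}$. Then there exists a positive constant $c$ such that for all $m\in\mathbb{N}$ and $f\in\Phi_{\lambda,2}(\mathbb{T})$ $$\|f-Q_m(f)\|_2\le c\,\varepsilon_m\|f\|_{\Phi_{\lambda,2}(\mathbb{T})},$$ and consequently $M_{2m+1}(U_{\lambda,2}(\mathbb{T}),\varphi_\beta)_2\le c\,\varepsilon_m$.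
   Context: $\mathbb{N}=\{1,2,\dots\}$; $\mathbb{T}=[0,2\pi]$ with endpoints identified. Functions are real-valued (in particular $\varphi_\lambda$ and $\varphi_\beta$). $\|f\|_2=(2\pi)^{-1/2}(\int_{\mathbb{T}}|f|^2)^{1/2}$; $\hat g(k)=(2\pi)^{-1}\int_{\mathbb{T}}g(x)e^{-ikx}dx$; $(f_1*f_2)(x)=(2\pi)^{-1}\int_{\mathbb{T}}f_1(y)f_2(x-y)dy$. For a sequence $\lambda$ with nonzero components, $\varphi_\lambda=\sum_{k\in\mathbb{Z}}\lambda_k^{-1}e^{ik\cdot}$ in the distributional sense; similarly $\varphi_\beta=\sum_{k\in\mathbb{Z}}\beta_k^{-1}e^{ik\cdot}$. $\Phi_{\lambda,2}(\mathbb{T})=\{f=\varphi_\lambda*g: g\in L_2(\mathbb{T})\}$ with $\|f\|_{\Phi_{\lambda,2}(\mathbb{T})}=\|g\|_2$, and $U_{\lambda,2}(\mathbb{T})$ is its unit ball. Put $\alpha_k=\beta_k/\lambda_k$, $H_m(x)=\sum_{|k|\le m}\alpha_k e^{ikx}$, $\delta_m=2\pi/(2m+1)$, $V_m(g)=H_m*g$, and for $f=\varphi_\lambda*g$ with $g\in L_2(\mathbb{T})$, $$Q_m(f)=\frac1{2m+1}\sum_{l=0}^{2m}V_m(g)(\delta_m l)\,\varphi_\beta(\cdot-\delta_m l).$$ $I_{m,j}=\{k\in\mathbb{Z}:(2m+1)j-m\le k\le(2m+1)j+m\}$. For $\mathbb{W}\subset L_2(\mathbb{T})$ and $\psi\in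 L_2(\mathbb{T})$, $M_n(\mathbb{W},\psi)_2=\sup_{f\in\mathbb{W}}\inf_{c_l\in\mathbb{R},\,y_l\in\mathbb{T}}\|f-\sum_{l=1}^n c_l\psi(\cdot-y_l)\|_2$. The quantity $\varepsilon_m$ may be $+\infty$, in which case the bound is trivial. *)

theory Defs
  imports "HOL-Analysis.Analysis"
begin

text \<open>
  A real function on the circle is a 2 pi-periodic function on the real line, and an element of
  the space L2 is given by a Borel representative (every class has one).
\<close>

definition per2pi :: "(real \<Rightarrow> 'a) \<Rightarrow> bool" where
  "per2pi f \<longleftrightarrow> (\<forall>x. f (x + 2 * pi) = f x)"

definition L2T :: "(real \<Rightarrow> real) set" where
  "L2T = {f. per2pi f \<and> f \<in> borel_measurable borel \<and>
             set_integrable lborel {0..2 * pi} (\<lambda>x. (f x)\<^sup>2)}"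

definition L2norm :: "(real \<Rightarrow> real) \<Rightarrow> real" where
  "L2norm f = (2 * pi) powr (- 1 / 2) * sqrt (LINT x:{0..2 * pi}|lborel. \<bar>f x\<bar>\<^sup>2)"

definition fourier_coeff :: "(real \<Rightarrow> real) \<Rightarrow> int \<Rightarrow> complex" where
  "fourier_coeff g k =
     (LINT x:{0..2 * pi}|lborel. complex_of_real (g x) * exp (- \<i> * of_int k * of_real x)) / (2 * pi)"

definition conv :: "(real \<Rightarrow> real) \<Rightarrow> (real \<Rightarrow> real) \<Rightarrow> real \<Rightarrow> real" where
  "conv f g x = (LINT y:{0..2 * pi}|lborel. f y * g (x - y)) / (2 * pi)"

text \<open>Smooth periodic test functions; \<open>D n\<close> is the derivative of order \<open>n\<close>.\<close>

definition test_fun :: "(real \<Rightarrow> complex) \<Rightarrow> bool" where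
  "test_fun u \<longleftrightarrow> per2pi u \<and>
     (\<exists>D. D 0 = u \<and> (\<forall>n x. (D n has_vector_derivative D (Suc n) x) (at x)))"

text \<open>
  \<open>distrib_series c \<phi>\<close>: the series with terms \<open>c k * exp (i k x)\<close> equals \<open>\<phi>\<close> in the sense of
  distributions, i.e. after pairing with an arbitrary test function.
\<close>

definition distrib_series :: "(int \<Rightarrow> complex) \<Rightarrow> (real \<Rightarrow> real) \<Rightarrow> bool" where
  "distrib_series c \<phi> \<longleftrightarrow> (\<forall>u. test_fun u \<longrightarrow>
     ((\<lambda>k. LINT x:{0..2 * pi}|lborel. c k * exp (\<i> * of_int k * of_real x) * u x)
        has_sum (LINT x:{0..2 * pi}|lborel. complex_of_real (\<phi> x) * u x)) UNIV)"

definition Phi_space :: "(real \<Rightarrow> real) \<Rightarrow> (real \<Rightarrow> real) set" where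
  "Phi_space \<phi> = {f \<in> L2T. \<exists>g\<in>L2T. AE x in lborel. f x = conv \<phi> g x}"

text \<open>
  The function \<open>g\<close> with \<open>f = \<phi> * g\<close>. If no Fourier coefficient of \<open>\<phi>\<close> vanishes, \<open>g\<close> is unique up
  to a null set, and only quantities which do not depend on the representative are formed from it.
\<close>

definition deconv :: "(real \<Rightarrow> real) \<Rightarrow> (real \<Rightarrow> real) \<Rightarrow> (real \<Rightarrow> real)" where
  "deconv \<phi> f = (SOME g. g \<in> L2T \<and> (AE x in lborel. f x = conv \<phi> g x))"

definition Phi_norm :: "(real \<Rightarrow> real) \<Rightarrow> (real \<Rightarrow> real) \<Rightarrow> real" where
  "Phi_norm \<phi> f = L2norm (deconv \<phi> f)"

definition U_ball :: "(real \<Rightarrow> real) \<Rightarrow> (real \<Rightarrow> real) set" where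
  "U_ball \<phi> = {f \<in> Phi_space \<phi>. Phi_norm \<phi> f \<le> 1}"

definition alpha :: "(int \<Rightarrow> complex) \<Rightarrow> (int \<Rightarrow> complex) \<Rightarrow> int \<Rightarrow> complex" where
  "alpha lam bet k = bet k / lam k"

text \<open>
  The sequences are complex. The trigonometric polynomial is real-valued when they are the
  reciprocals of Fourier coefficients of real functions (lemma \<open>of_real_H_poly\<close> below), so that
  taking the real part only changes the type.
\<close>

definition H_poly :: "(int \<Rightarrow> complex) \<Rightarrow> (int \<Rightarrow> complex) \<Rightarrow> nat \<Rightarrow> real \<Rightarrow> real" where
  "H_poly lam bet m x =
     Re (\<Sum>k\<in>{- int m..int m}. alpha lam bet k * exp (\<i> * of_int k * of_real x))"

definition delta :: "nat \<Rightarrow> real" where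
  "delta m = 2 * pi / (2 * real m + 1)"

definition V_op ::
  "(int \<Rightarrow> complex) \<Rightarrow> (int \<Rightarrow> complex) \<Rightarrow> nat \<Rightarrow> (real \<Rightarrow> real) \<Rightarrow> real \<Rightarrow> real" where
  "V_op lam bet m g = conv (H_poly lam bet m) g"

definition Q_op ::
  "(int \<Rightarrow> complex) \<Rightarrow> (int \<Rightarrow> complex) \<Rightarrow> (real \<Rightarrow> real) \<Rightarrow> (real \<Rightarrow> real) \<Rightarrow> nat
     \<Rightarrow> (real \<Rightarrow> real) \<Rightarrow> real \<Rightarrow> real" where
  "Q_op lam bet \<phi>lam \<phi>bet m f x =
     1 / (2 * real m + 1) *
     (\<Sum>l\<in>{0..2 * m}. V_op lam bet m (deconv \<phi>lam f) (delta m * real l)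
                        * \<phi>bet (x - delta m * real l))"

definition kprime :: "nat \<Rightarrow> int \<Rightarrow> int" where
  "kprime m k = (THE k'. k' \<in> {- int m..int m} \<and> (2 * int m + 1) dvd (k - k'))"

definition gamma_coeff ::
  "(int \<Rightarrow> complex) \<Rightarrow> (int \<Rightarrow> complex) \<Rightarrow> nat \<Rightarrow> int \<Rightarrow> complex" where
  "gamma_coeff lam bet m k = alpha lam bet (kprime m k) * inverse (bet k)"

definition I_block :: "nat \<Rightarrow> int \<Rightarrow> int set" where
  "I_block m j = {(2 * int m + 1) * j - int m..(2 * int m + 1) * j + int m}"

definition Gamma_max :: "(int \<Rightarrow> complex) \<Rightarrow> (int \<Rightarrow> complex) \<Rightarrow> nat \<Rightarrow> int \<Rightarrow> real" where
  "Gamma_max lam bet m j = Max ((\<lambda>k. cmod (gamma_coeff lam bet m k)) ` I_block m j)"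

definition eps :: "(int \<Rightarrow> complex) \<Rightarrow> (int \<Rightarrow> complex) \<Rightarrow> nat \<Rightarrow> ennreal" where
  "eps lam bet m =
     max (SUP k\<in>{k. \<bar>k\<bar> > int m}. ennreal (cmod (inverse (lam k))))
         (if (\<lambda>j. (Gamma_max lam bet m j)\<^sup>2) summable_on {j. j \<noteq> 0}
          then ennreal (sqrt (\<Sum>\<^sub>\<infinity>j\<in>{j. j \<noteq> 0}. (Gamma_max lam bet m j)\<^sup>2))
          else \<infinity>)"

definition M_width :: "nat \<Rightarrow> (real \<Rightarrow> real) set \<Rightarrow> (real \<Rightarrow> real) \<Rightarrow> ennreal" where
  "M_width n W \<psi> =
     (SUP f\<in>W. INF (c, y)\<in>{(c :: nat \<Rightarrow> real, y :: nat \<Rightarrow> real). \<forall>l\<in>{1..n}. y l \<in> {0..2 * pi}}.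
        ennreal (L2norm (\<lambda>x. f x - (\<Sum>l\<in>{1..n}. c l * \<psi> (x - y l)))))"

lemma integral_exp_period:
  "(LINT x:{0..2 * pi}|lborel. exp (\<i> * of_int n * complex_of_real x)) =
     (if n = 0 then 2 * pi else 0)"
proof (cases "n = 0")
  case True
  then show ?thesis
    by (simp add: set_lebesgue_integral_def scaleR_conv_of_real)
next
  case False
  define F where "F = (\<lambda>x::real. exp (\<i> * of_int n * complex_of_real x) / (\<i> * of_int n))"
  have "(LBINT x=ereal 0..ereal (2 * pi). exp (\<i> * of_int n * complex_of_real x)) = F (2 * pi) - F 0"
  proof (rule interval_integral_FTC_finite)
    show "continuous_on {min 0 (2*pi)..max 0 (2*pi)} (\<lambda>x. exp (\<i> * of_int n * complex_of_real x))"
      by (intro continuous_intros)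
    fix x :: real
    have "((\<lambda>z. exp (\<i> * of_int n * z) / (\<i> * of_int n)) has_field_derivative
             exp (\<i> * of_int n * of_real x)) (at (of_real x))"
      using False by (auto intro!: derivative_eq_intros)
    then show "(F has_vector_derivative exp (\<i> * of_int n * complex_of_real x))
                 (at x within {min 0 (2*pi)..max 0 (2*pi)})"
      unfolding F_def
      by (intro has_vector_derivative_real_field has_vector_derivative_at_within)
  qed
  moreover have "exp (\<i> * of_int n * complex_of_real (2 * pi)) = 1"
    by (subst exp_eq_1) (auto simp: mult_ac)
  ultimately have "(LBINT x=ereal 0..ereal (2 * pi). exp (\<i> * of_int n * complex_of_real x)) = 0"
    by (simp add: F_def)
  then show ?thesis
    using False by (subst (asm) interval_integral_Icc) auto
qed

lemma test_fun_exp: "test_fun (\<lambda>x. exp (- \<i> * of_int n * of_real x))"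
  unfolding test_fun_def
proof (intro conjI exI allI)
  show "per2pi (\<lambda>x. exp (- \<i> * of_int n * of_real x))"
    unfolding per2pi_def
  proof
    fix x :: real
    have "exp (- \<i> * of_int n * complex_of_real (2 * pi)) = 1"
      by (subst exp_eq_1) (auto intro!: exI[of _ "- n"] simp: mult_ac)
    then show "exp (- \<i> * of_int n * complex_of_real (x + 2 * pi)) =
               exp (- \<i> * of_int n * complex_of_real x)"
      by (simp only: of_real_add distrib_left exp_add) simp
  qed
  let ?D = "\<lambda>k x. (- \<i> * of_int n) ^ k * exp (- \<i> * of_int n * complex_of_real x)"
  show "?D 0 = (\<lambda>x. exp (- \<i> * of_int n * of_real x))"
    by simp
  fix k x
  have "((\<lambda>z. (- \<i> * of_int n) ^ k * exp (- \<i> * of_int n * z)) has_field_derivative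
          ?D (Suc k) x) (at (of_real x))"
    by (auto intro!: derivative_eq_intros)
  then show "(?D k has_vector_derivative ?D (Suc k) x) (at x)"
    by (rule has_vector_derivative_real_field)
qed

lemma fourier_coeff_distrib_series:
  assumes "distrib_series c \<phi>"
  shows "fourier_coeff \<phi> n = c n"
proof -
  have eq: "(LINT x:{0..2 * pi}|lborel. c k * exp (\<i> * of_int k * of_real x) *
               exp (- \<i> * of_int n * of_real x)) = (if k = n then 2 * pi * c n else 0)" for k
  proof -
    have "exp (\<i> * of_int k * of_real x) * exp (- \<i> * of_int n * of_real x) =
          exp (\<i> * of_int (k - n) * complex_of_real x)" for x :: real
      unfolding exp_add[symmetric] by (simp add: algebra_simps)
    then have "c k * exp (\<i> * of_int k * of_real x) * exp (- \<i> * of_int n * of_real x) =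
          c k * exp (\<i> * of_int (k - n) * complex_of_real x)" for x :: real
      by (simp only: mult.assoc)
    then show ?thesis
      by (simp only: set_integral_mult_right integral_exp_period) auto
  qed
  have "((\<lambda>k. if k = n then 2 * pi * c n else 0) has_sum
          (LINT x:{0..2 * pi}|lborel. complex_of_real (\<phi> x) * exp (- \<i> * of_int n * of_real x))) UNIV"
  proof -
    from assms test_fun_exp[of n] show ?thesis
      unfolding distrib_series_def eq[symmetric] by (elim allE impE) assumption+
  qed
  moreover have "((\<lambda>k. if k = n then 2 * pi * c n else 0) has_sum (2 * pi * c n)) UNIV"
    by (rule has_sum_finite_neutralI[of "{n}"]) auto
  ultimately have "(LINT x:{0..2 * pi}|lborel. complex_of_real (\<phi> x) *
                      exp (- \<i> * of_int n * of_real x)) = 2 * pi * c n"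
    by (rule has_sum_unique)
  then show ?thesis
    by (simp add: fourier_coeff_def)
qed

lemma fourier_coeff_uminus: "fourier_coeff g (- k) = cnj (fourier_coeff g k)"
proof -
  have "cnj (complex_lebesgue_integral lborel
          (\<lambda>x. indicator {0..2 * pi} x *\<^sub>R (complex_of_real (g x) * exp (- \<i> * of_int k * of_real x)))) =
        complex_lebesgue_integral lborel
          (\<lambda>x. cnj (indicator {0..2 * pi} x *\<^sub>R (complex_of_real (g x) * exp (- \<i> * of_int k * of_real x))))"
    by (rule Bochner_Integration.integral_cnj[symmetric])
  then show ?thesis
    by (simp add: fourier_coeff_def set_lebesgue_integral_def exp_cnj)
qed

lemma of_real_H_poly:
  assumes "distrib_series (\<lambda>k. inverse (lam k)) \<phi>lam" "distrib_series (\<lambda>k. inverse (bet k)) \<phi>bet"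
  shows "complex_of_real (H_poly lam bet m x) =
           (\<Sum>k\<in>{- int m..int m}. alpha lam bet k * exp (\<i> * of_int k * of_real x))"
proof -
  have sym: "lam (- k) = cnj (lam k)" "bet (- k) = cnj (bet k)" for k
    using fourier_coeff_distrib_series[OF assms(1)] fourier_coeff_distrib_series[OF assms(2)]
          fourier_coeff_uminus
    by (metis complex_cnj_inverse inverse_inverse_eq)+
  let ?S = "\<Sum>k\<in>{- int m..int m}. alpha lam bet k * exp (\<i> * of_int k * complex_of_real x)"
  have "cnj ?S = (\<Sum>k\<in>{- int m..int m}. alpha lam bet (- k) *
                    exp (\<i> * of_int (- k) * complex_of_real x))"
    by (simp add: alpha_def sym exp_cnj)
  also have "\<dots> = ?S"
    by (rule sum.reindex_bij_witness[of _ uminus uminus]) auto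
  finally have "?S \<in> \<real>"
    by (simp only: Reals_cnj_iff)
  then show ?thesis
    unfolding H_poly_def by (rule of_real_Re)
qed

end

theory Submission
  imports Defs
begin

text \<open>
  Sampling aliases frequencies: the coefficient of \<open>Q_m f\<close> at \<open>k\<close> is \<open>\<gamma>\<^sub>k\<close> times the
  coefficient of \<open>g\<close> at \<open>k'\<close>. As \<open>\<gamma>\<^sub>k = 1 / \<lambda>\<^sub>k\<close> for \<open>\<bar>k\<bar> \<le> m\<close>, the coefficients of
  \<open>f - Q_m f\<close> vanish there; for \<open>\<bar>k\<bar> > m\<close> both contributions are estimated separately, the second
  one block by block, since \<open>k'\<close> runs through \<open>{- m..m}\<close> once on every block. Bessel's
  inequality for \<open>g\<close> and Parseval's identity for \<open>f - Q_m f\<close> then give the bound with \<open>c = 2\<close>.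
\<close>

subsection \<open>Fourier coefficients and Bessel's inequality\<close>

text \<open>The estimates never sum a Fourier series. The function \<open>g\<close> is merely the
  choice made by \<open>deconv\<close>, and the equation between \<open>f\<close> and the
  convolution holds only almost everywhere. So everything is read off from single coefficients,
  which do not see null sets, and from finite sums of their squares. Parseval's identity enters as a
  bound from above: if every finite sum of squared coefficients is at most \<open>B\<close>, so is
  the squared norm. This rests on the density of trigonometric polynomials, the analytic core of the
  argument. Aliasing occurs because \<open>2 * m + 1\<close> equispaced nodes cannot tell apart
  frequencies that are congruent modulo \<open>2 * m + 1\<close>.\<close>

definition circ :: "real measure" where
  "circ = restrict_space lborel {0..2 * pi}"

lemma set_integrable_circ:
  fixes f :: "real \<Rightarrow> 'a::{banach, second_countable_topology}"
  shows "set_integrable lborel {0..2 * pi} f \<longleftrightarrow> integrable circ f"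
  unfolding circ_def by (rule set_integrable_eq) simp

lemma set_integral_circ:
  fixes f :: "real \<Rightarrow> 'a::{banach, second_countable_topology}"
  shows "(LINT x:{0..2 * pi}|lborel. f x) = (LINT x|circ. f x)"
  unfolding circ_def set_lebesgue_integral_def by (rule integral_restrict_space[symmetric]) simp

lemma measurable_circ: "f \<in> borel_measurable borel \<Longrightarrow> f \<in> borel_measurable circ"
  unfolding circ_def by (rule measurable_restrict_space1) simp

lemma finite_measure_circ: "finite_measure circ"
  unfolding circ_def by (rule finite_measureI) (simp add: emeasure_restrict_space space_restrict_space)

text \<open>Integrating against a finite measure, instead of over a set, admits constants as
  dominating functions and, through the product below, Fubini's theorem.\<close>

interpretation circ: finite_measure circ
  by (rule finite_measure_circ)

interpretation circ2: pair_sigma_finite circ circ ..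

lemma AE_circ:
  assumes "AE x in lborel. 0 \<le> x \<longrightarrow> x \<le> 2 * pi \<longrightarrow> P x"
  shows "AE x in circ. P x"
  using assms unfolding circ_def by (subst AE_restrict_space_iff) auto

lemma measure_circ: "measure circ (space circ) = 2 * pi"
  unfolding circ_def by (simp add: measure_restrict_space space_restrict_space)

definition cexp :: "int \<Rightarrow> real \<Rightarrow> complex" where
  "cexp k x = exp (\<i> * of_int k * of_real x)"

lemma continuous_cexp [continuous_intros]: "continuous_on S (cexp k)"
  unfolding cexp_def by (intro continuous_intros)

lemma measurable_cexp [measurable]: "cexp k \<in> borel_measurable borel"
  by (intro borel_measurable_continuous_onI continuous_cexp)

lemma norm_cexp [simp]: "cmod (cexp k x) = 1"
  unfolding cexp_def by (simp add: norm_exp_eq_Re)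

lemma cexp_0 [simp]: "cexp 0 x = 1" "cexp k 0 = 1"
  by (simp_all add: cexp_def)

lemma cnj_cexp: "cnj (cexp k x) = cexp (- k) x"
  by (simp add: cexp_def exp_cnj)

lemma cexp_mult: "cexp k x * cexp l x = cexp (k + l) x"
  by (simp add: cexp_def exp_add [symmetric] algebra_simps)

lemma cexp_diff: "cexp (k - l) x = cexp k x * cexp (- l) x"
  by (simp add: cexp_mult)

lemma cexp_add: "cexp k (x + y) = cexp k x * cexp k y"
  by (simp add: cexp_def exp_add [symmetric] algebra_simps)

lemma cexp_uminus: "cexp k (- x) = cexp (- k) x"
  by (simp add: cexp_def)

lemma cexp_2pi [simp]: "cexp k (2 * pi) = 1"
  unfolding cexp_def by (subst exp_eq_1) (auto simp: mult_ac)

lemma per2pi_cexp: "per2pi (cexp k)"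
  by (simp add: per2pi_def cexp_add)

lemma integrable_cexp_mult:
  assumes "integrable circ f"
  shows "integrable circ (\<lambda>x. f x * cexp k x)"
proof (rule Bochner_Integration.integrable_bound[OF assms])
  show "(\<lambda>x. f x * cexp k x) \<in> borel_measurable circ"
    by (intro borel_measurable_times borel_measurable_integrable[OF assms] measurable_circ measurable_cexp)
qed (simp add: norm_mult)

lemma integrable_cexp: "integrable circ (cexp k)"
  using integrable_cexp_mult[of "\<lambda>_. 1" k] by simp

lemma integral_cexp: "(LINT x|circ. cexp k x) = (if k = 0 then 2 * pi else 0)"
  using integral_exp_period[of k] by (simp add: set_integral_circ cexp_def)

lemma fourier_coeff_circ:
  "fourier_coeff g k = (LINT x|circ. complex_of_real (g x) * cexp (- k) x) / (2 * pi)"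
  by (simp add: fourier_coeff_def cexp_def set_integral_circ)

lemma L2T_measurable: "f \<in> L2T \<Longrightarrow> f \<in> borel_measurable borel"
  and L2T_per2pi: "f \<in> L2T \<Longrightarrow> per2pi f"
  and L2T_integrable_square: "f \<in> L2T \<Longrightarrow> integrable circ (\<lambda>x. (f x)\<^sup>2)"
  by (auto simp: L2T_def set_integrable_circ)

lemma L2T_integrable:
  assumes "f \<in> L2T"
  shows "integrable circ f"
proof (rule Bochner_Integration.integrable_bound)
  show "integrable circ (\<lambda>x. 1 + (f x)\<^sup>2)"
    using L2T_integrable_square[OF assms] by simp
  show "f \<in> borel_measurable circ"
    by (intro measurable_circ L2T_measurable assms)
  \<comment> \<open>From \<open>(\<bar>y\<bar> - 1)\<^sup>2 \<ge> 0\<close>.\<close>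
  have "\<bar>y\<bar> \<le> \<bar>1 + y\<^sup>2\<bar>" for y :: real
    using abs_triangle_ineq2 zero_le_power2[of "\<bar>y\<bar> - 1"] abs_ge_zero[of y]
    by (simp add: power2_diff)
  then show "AE x in circ. norm (f x) \<le> norm (1 + (f x)\<^sup>2)"
    by simp
qed

lemma L2norm_nonneg: "L2norm f \<ge> 0"
  by (simp add: L2norm_def set_lebesgue_integral_def)

lemma L2norm_square: "(L2norm f)\<^sup>2 = (LINT x|circ. (f x)\<^sup>2) / (2 * pi)"
proof -
  have "((2 * pi) powr (- 1 / 2))\<^sup>2 = 1 / (2 * pi)"
    by (simp add: powr_minus powr_half_sqrt power_inverse inverse_eq_divide power_divide)
  then show ?thesis
    unfolding L2norm_def set_integral_circ
    by (simp add: power_mult_distrib)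
qed

text \<open>Orthogonality and completing the square in the \<open>a k\<close>. With
  \<open>a = fourier_coeff f\<close> this yields Bessel's inequality; with the coefficients of a
  close approximation it controls the norm of \<open>f\<close> by finitely many Fourier
  coefficients.\<close>

lemma trig_poly_distance:
  assumes f: "f \<in> L2T" and A: "finite A"
  shows "integrable circ (\<lambda>x. (cmod (of_real (f x) - (\<Sum>k\<in>A. a k * cexp k x)))\<^sup>2)"
    and "(LINT x|circ. (cmod (of_real (f x) - (\<Sum>k\<in>A. a k * cexp k x)))\<^sup>2) / (2 * pi) =
           (L2norm f)\<^sup>2 - (\<Sum>k\<in>A. (cmod (fourier_coeff f k))\<^sup>2) +
           (\<Sum>k\<in>A. (cmod (a k - fourier_coeff f k))\<^sup>2)"
proof -
  define p where "p = (\<lambda>x. \<Sum>k\<in>A. a k * cexp k x)"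
  define c where "c = fourier_coeff f"
  have int_f: "integrable circ (\<lambda>x. complex_of_real (f x))"
    using L2T_integrable[OF f] by (rule integrable_of_real)
  have int_f2: "integrable circ (\<lambda>x. complex_of_real ((f x)\<^sup>2))"
    using L2T_integrable_square[OF f] by (rule integrable_of_real)
  have int_fe: "integrable circ (\<lambda>x. of_real (f x) * cexp k x)" for k
    by (rule integrable_cexp_mult[OF int_f])
  have int_term: "integrable circ (\<lambda>x. cnj (a k) * (of_real (f x) * cexp (- k) x))"
      "integrable circ (\<lambda>x. a k * (of_real (f x) * cexp k x))"
      "integrable circ (\<lambda>x. a k * cnj (a l) * cexp (k - l) x)" for k l
    using int_fe integrable_cexp by (intro integrable_mult_right; blast)+
  \<comment> \<open>The form \<open>z * cnj z\<close> replaces the modulus by terms linear in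
    characters: apart from the square of \<open>f\<close>, each integrates to a Fourier coefficient
    or by orthogonality.\<close>
  have expand: "complex_of_real ((cmod (of_real (f x) - p x))\<^sup>2) =
      of_real ((f x)\<^sup>2) - (\<Sum>k\<in>A. cnj (a k) * (of_real (f x) * cexp (- k) x))
       - (\<Sum>k\<in>A. a k * (of_real (f x) * cexp k x))
       + (\<Sum>k\<in>A. \<Sum>l\<in>A. a k * cnj (a l) * cexp (k - l) x)" for x
  proof -
    have "p x * cnj (p x) = (\<Sum>k\<in>A. \<Sum>l\<in>A. a k * cnj (a l) * cexp (k - l) x)"
      unfolding p_def cnj_sum sum_product
      by (intro sum.cong refl) (simp add: cnj_cexp cexp_diff mult_ac)
    moreover have "complex_of_real (f x) * cnj (p x) = (\<Sum>k\<in>A. cnj (a k) * (of_real (f x) * cexp (- k) x))"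
      unfolding p_def cnj_sum sum_distrib_left by (intro sum.cong refl) (simp add: cnj_cexp)
    moreover have "complex_of_real (f x) * p x = (\<Sum>k\<in>A. a k * (of_real (f x) * cexp k x))"
      unfolding p_def sum_distrib_left by (intro sum.cong refl) simp
    ultimately show ?thesis
      unfolding complex_norm_square by (simp add: algebra_simps power2_eq_square)
  qed
  have int_c: "integrable circ (\<lambda>x. complex_of_real ((cmod (of_real (f x) - p x))\<^sup>2))"
    unfolding expand
    by (intro Bochner_Integration.integrable_add Bochner_Integration.integrable_diff
        Bochner_Integration.integrable_sum int_f2 int_term)
  then show "integrable circ (\<lambda>x. (cmod (of_real (f x) - (\<Sum>k\<in>A. a k * cexp k x)))\<^sup>2)"
    unfolding p_def by (simp only: complex_of_real_integrable_eq)
  have c_eq: "(LINT x|circ. of_real (f x) * cexp (- k) x) = 2 * pi * c k" for k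
    by (simp add: c_def fourier_coeff_circ)
  \<comment> \<open>Since \<open>f\<close> is real, the coefficient at \<open>- k\<close> is the
    conjugate of the one at \<open>k\<close>.\<close>
  have c_cnj: "(LINT x|circ. of_real (f x) * cexp k x) = 2 * pi * cnj (c k)" for k
    using c_eq[of "- k"] by (simp add: c_def fourier_coeff_uminus)
  have "(LINT x|circ. complex_of_real ((cmod (of_real (f x) - p x))\<^sup>2)) =
      of_real (LINT x|circ. (f x)\<^sup>2) - (\<Sum>k\<in>A. cnj (a k) * (2 * pi * c k))
       - (\<Sum>k\<in>A. a k * (2 * pi * cnj (c k)))
       + (\<Sum>k\<in>A. \<Sum>l\<in>A. a k * cnj (a l) * (if k - l = 0 then 2 * pi else 0))"
    unfolding expand
    by (simp only: int_f2 int_term Bochner_Integration.integrable_sum Bochner_Integration.integral_sum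
        Bochner_Integration.integrable_add Bochner_Integration.integral_add
        Bochner_Integration.integrable_diff Bochner_Integration.integral_diff
        integral_mult_right_zero integral_complex_of_real c_eq c_cnj integral_cexp)
  also have "(\<Sum>k\<in>A. \<Sum>l\<in>A. a k * cnj (a l) * (if k - l = 0 then 2 * pi else 0)) =
      (\<Sum>k\<in>A. a k * cnj (a k) * (2 * pi))"
    using A by (intro sum.cong refl) (simp add: if_distrib sum.delta cong: if_cong)
  also have "of_real (LINT x|circ. (f x)\<^sup>2) - (\<Sum>k\<in>A. cnj (a k) * (2 * pi * c k))
       - (\<Sum>k\<in>A. a k * (2 * pi * cnj (c k))) + (\<Sum>k\<in>A. a k * cnj (a k) * (2 * pi)) =
      of_real (2 * pi * (L2norm f)\<^sup>2) + 2 * pi *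
        (\<Sum>k\<in>A. a k * cnj (a k) - cnj (a k) * c k - a k * cnj (c k))"
    by (simp add: L2norm_square sum_subtractf sum.distrib sum_distrib_left algebra_simps)
  \<comment> \<open>Completing the square for each \<open>k\<close> absorbs both cross
    terms.\<close>
  also have "(\<Sum>k\<in>A. a k * cnj (a k) - cnj (a k) * c k - a k * cnj (c k)) =
      (\<Sum>k\<in>A. of_real ((cmod (a k - c k))\<^sup>2) - of_real ((cmod (c k))\<^sup>2))"
    by (intro sum.cong refl) (simp only: complex_norm_square, simp add: algebra_simps)
  also have "of_real (2 * pi * (L2norm f)\<^sup>2) + 2 * pi * \<dots> =
      complex_of_real (2 * pi * ((L2norm f)\<^sup>2 +
        (\<Sum>k\<in>A. (cmod (a k - c k))\<^sup>2 - (cmod (c k))\<^sup>2)))"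
    by (simp add: algebra_simps)
  finally have "(LINT x|circ. (cmod (of_real (f x) - p x))\<^sup>2) =
      2 * pi * ((L2norm f)\<^sup>2 + (\<Sum>k\<in>A. (cmod (a k - c k))\<^sup>2 - (cmod (c k))\<^sup>2))"
    by (simp only: integral_complex_of_real of_real_eq_iff)
  then show "(LINT x|circ. (cmod (of_real (f x) - (\<Sum>k\<in>A. a k * cexp k x)))\<^sup>2) / (2 * pi) =
           (L2norm f)\<^sup>2 - (\<Sum>k\<in>A. (cmod (fourier_coeff f k))\<^sup>2) +
           (\<Sum>k\<in>A. (cmod (a k - fourier_coeff f k))\<^sup>2)"
    unfolding p_def c_def by (simp add: sum_subtractf)
qed

lemma Bessel_inequality:
  assumes "f \<in> L2T" "finite A"
  shows "(\<Sum>k\<in>A. (cmod (fourier_coeff f k))\<^sup>2) \<le> (L2norm f)\<^sup>2"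
proof -
  let ?D = "LINT x|circ. (cmod (of_real (f x) - (\<Sum>k\<in>A. fourier_coeff f k * cexp k x)))\<^sup>2"
  have "0 \<le> ?D / (2 * pi)"
    by (intro divide_nonneg_nonneg integral_nonneg_AE) auto
  then show ?thesis
    using trig_poly_distance(2)[OF assms, of "fourier_coeff f"] by simp
qed

subsection \<open>Completeness of the trigonometric system\<close>

text \<open>The inductive form makes closure under products a double induction and suits the
  induction on \<open>real_polynomial_function\<close>; \<open>trig_poly_sum_form\<close> recovers
  the explicit sum that the distance identity requires.\<close>

inductive trig_poly :: "(real \<Rightarrow> complex) \<Rightarrow> bool" where
  monom: "trig_poly (\<lambda>x. c * cexp k x)"
| add: "trig_poly p \<Longrightarrow> trig_poly q \<Longrightarrow> trig_poly (\<lambda>x. p x + q x)"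

lemma trig_poly_const: "trig_poly (\<lambda>x. c)"
  using trig_poly.monom[of c 0] by simp

lemma trig_poly_mult:
  assumes "trig_poly p" "trig_poly q"
  shows "trig_poly (\<lambda>x. p x * q x)"
  using assms(1)
proof induction
  case (monom c k)
  from assms(2) show ?case
  proof induction
    case (monom d l)
    have "(\<lambda>x. c * cexp k x * (d * cexp l x)) = (\<lambda>x. c * d * cexp (k + l) x)"
      by (simp add: cexp_mult[symmetric] mult_ac)
    then show ?case
      by (simp only: trig_poly.monom)
  qed (simp add: distrib_left trig_poly.add)
qed (simp add: distrib_right trig_poly.add)

lemma trig_poly_sum_form:
  assumes "trig_poly p"
  obtains A a where "finite A" "p = (\<lambda>x. \<Sum>k\<in>A. a k * cexp k x)"
  using assms
proof (induction arbitrary: thesis)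
  case (monom c k)
  show ?case
    by (rule monom[of "{k}" "\<lambda>_. c"]) auto
next
  case (add p q)
  obtain A a where A: "finite A" "p = (\<lambda>x. \<Sum>k\<in>A. a k * cexp k x)"
    using add.IH(1) .
  obtain B b where B: "finite B" "q = (\<lambda>x. \<Sum>k\<in>B. b k * cexp k x)"
    using add.IH(2) .
  \<comment> \<open>Both families are extended by zero to the union, so that common frequencies add
    up.\<close>
  define c where "c k = (if k \<in> A then a k else 0) + (if k \<in> B then b k else 0)" for k
  have "(\<Sum>k\<in>A \<union> B. c k * cexp k x) = p x + q x" for x
  proof -
    have "(\<Sum>k\<in>A \<union> B. (if k \<in> A then a k else 0) * cexp k x) = p x"
      unfolding A(2) using A(1) B(1) by (intro sum.mono_neutral_cong_right) auto
    moreover have "(\<Sum>k\<in>A \<union> B. (if k \<in> B then b k else 0) * cexp k x) = q x"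
      unfolding B(2) using A(1) B(1) by (intro sum.mono_neutral_cong_right) auto
    ultimately show ?thesis
      unfolding c_def by (simp only: distrib_right sum.distrib)
  qed
  then show ?case
    using A(1) B(1) by (intro add.prems[of "A \<union> B" c]) auto
qed

lemma measurable_trig_poly: "trig_poly p \<Longrightarrow> p \<in> borel_measurable borel"
  by (induction rule: trig_poly.induct) auto

text \<open>On the unit circle a real linear functional is a combination of cosine and sine, hence
  of \<open>cexp 1\<close> and \<open>cexp (- 1)\<close>; constants, sums and products stay within
  the class. This turns the polynomials of the Stone-Weierstrass theorem into trigonometric
  ones.\<close>

lemma trig_poly_real_polynomial:
  fixes g :: "complex \<Rightarrow> real"
  assumes "real_polynomial_function g"
  shows "trig_poly (\<lambda>x. complex_of_real (g (cis x)))"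
  using assms
proof induction
  case (linear f)
  interpret f: bounded_linear f by fact
  have "complex_of_real (f (cis x)) =
      ((of_real (f 1) - \<i> * of_real (f \<i>)) / 2) * cexp 1 x +
      ((of_real (f 1) + \<i> * of_real (f \<i>)) / 2) * cexp (- 1) x" for x
  proof -
    have "cis x = cos x *\<^sub>R 1 + sin x *\<^sub>R \<i>"
      by (simp add: complex_eq_iff)
    then have "f (cis x) = cos x * f 1 + sin x * f \<i>"
      by (simp only: f.add f.scale real_scaleR_def)
    moreover have e: "cexp 1 x = cos x + \<i> * sin x" "cexp (- 1) x = cos x - \<i> * sin x"
      by (simp_all add: cexp_def exp_Euler cos_of_real sin_of_real flip: exp_minus)
         (simp add: exp_minus_Euler cos_of_real sin_of_real)
    ultimately show ?thesis
      unfolding e by (simp add: field_simps)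
  qed
  then show ?case
    by (simp only: trig_poly.intros)
qed (simp_all add: trig_poly_const trig_poly.add trig_poly_mult)

text \<open>\<open>Arg2pi\<close> jumps at 1, so continuity does not follow by composition. Instead,
  the preimage of a closed set in the circle is the \<open>cis\<close>-image of a compact subset of
  \<open>{0..2 * pi}\<close>, hence closed.\<close>

lemma continuous_on_circle_lift:
  fixes u :: "real \<Rightarrow> 'a::topological_space"
  assumes "continuous_on {0..2 * pi} u" "u 0 = u (2 * pi)"
  shows "continuous_on (sphere 0 1) (\<lambda>z. u (Arg2pi z))"
    and "\<And>x. x \<in> {0..2 * pi} \<Longrightarrow> u (Arg2pi (cis x)) = u x"
proof -
  \<comment> \<open>\<open>Arg2pi\<close> stays below \<open>2 * pi\<close> and sends
    \<open>cis (2 * pi)\<close> to 0; there the equal end values are used.\<close>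
  show lift: "u (Arg2pi (cis x)) = u x" if "x \<in> {0..2 * pi}" for x
  proof (cases "x = 2 * pi")
    case False
    then have "Arg2pi (cis x) = x"
      using that by (intro Arg2pi_unique[of 1]) (auto simp: cis_conv_exp)
    then show ?thesis by simp
  qed (use assms(2) in \<open>simp add: Arg2pi_of_real[of 1, simplified]\<close>)
  show "continuous_on (sphere 0 1) (\<lambda>z. u (Arg2pi z))"
    unfolding continuous_on_closed_invariant
  proof (intro allI impI)
    fix B :: "'a set"
    assume "closed B"
    then have "closed ({0..2 * pi} \<inter> u -` B)"
      using assms(1) continuous_on_closed_vimage[of "{0..2 * pi}" u] by (simp add: Int_commute)
    then have "compact ({0..2 * pi} \<inter> u -` B)"
      unfolding compact_eq_bounded_closed
      by (auto intro: bounded_subset[OF bounded_closed_interval])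
    then have "closed (cis ` ({0..2 * pi} \<inter> u -` B))"
      by (intro compact_imp_closed compact_continuous_image continuous_intros)
    moreover have "cis ` ({0..2 * pi} \<inter> u -` B) \<inter> sphere 0 1 =
        (\<lambda>z. u (Arg2pi z)) -` B \<inter> sphere 0 1"
    proof (intro equalityI subsetI)
      fix z assume z: "z \<in> (\<lambda>z. u (Arg2pi z)) -` B \<inter> sphere 0 1"
      then have "z = cis (Arg2pi z)"
        using Arg2pi_eq[of z] by (simp add: cis_conv_exp)
      moreover have "Arg2pi z \<in> {0..2 * pi}"
        using Arg2pi_ge_0[of z] Arg2pi_lt_2pi[of z] by simp
      ultimately show "z \<in> cis ` ({0..2 * pi} \<inter> u -` B) \<inter> sphere 0 1"
        using z by blast
    qed (use lift in auto)
    ultimately show "\<exists>A. closed A \<and> A \<inter> sphere 0 1 = (\<lambda>z. u (Arg2pi z)) -` B \<inter> sphere 0 1"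
      by blast
  qed
qed

lemma trig_poly_uniform_approx:
  fixes u :: "real \<Rightarrow> real"
  assumes u: "continuous_on {0..2 * pi} u" "u 0 = u (2 * pi)" and "e > 0"
  obtains p where "trig_poly p" "\<And>x. x \<in> {0..2 * pi} \<Longrightarrow> cmod (of_real (u x) - p x) < e"
proof -
  obtain g where g: "real_polynomial_function g"
      "\<And>z. z \<in> sphere (0::complex) 1 \<Longrightarrow> \<bar>u (Arg2pi z) - g z\<bar> < e"
    using Stone_Weierstrass_real_polynomial_function[OF compact_sphere
        continuous_on_circle_lift(1)[OF u] \<open>e > 0\<close>] by blast
  show ?thesis
  proof
    show "trig_poly (\<lambda>x. complex_of_real (g (cis x)))"
      by (rule trig_poly_real_polynomial) (rule g)
    fix x :: real assume "x \<in> {0..2 * pi}"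
    then show "cmod (of_real (u x) - of_real (g (cis x))) < e"
      using g(2)[of "cis x"] continuous_on_circle_lift(2)[OF u]
      by (simp flip: of_real_diff)
  qed
qed

section \<open>Density of trigonometric polynomials in the square norm\<close>

lemma AE_space_circ: "AE x in circ. x \<in> {0..2 * pi}"
  by (rule AE_circ) auto

lemma AE_circ_imp:
  assumes "AE x in lborel. P x"
  shows "AE x in circ. P x"
  using assms by (intro AE_circ) auto

text \<open>
  Square integrable functions are truncated, then approximated by continuous functions which
  vanish at both end points, and these by trigonometric polynomials (Stone--Weierstrass on the unit
  circle).
\<close>

lemma truncation_approx:
  fixes f :: "real \<Rightarrow> real"
  assumes [measurable]: "f \<in> borel_measurable borel"
    and int: "integrable circ (\<lambda>x. (f x)\<^sup>2)" and "e > 0"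
  obtains M :: real where "M \<ge> 0" "(LINT x|circ. (f x - max (- M) (min M (f x)))\<^sup>2) < e"
proof -
  let ?F = "\<lambda>n x. (f x - max (- real n) (min (real n) (f x)))\<^sup>2"
  \<comment> \<open>At each point the difference vanishes once \<open>n\<close> reaches
    \<open>\<bar>f x\<bar>\<close>, and truncation towards 0 never makes it larger in modulus than
    \<open>f x\<close>.\<close>
  have "(\<lambda>n. LINT x|circ. ?F n x) \<longlonglongrightarrow> (LINT x|circ. 0)"
  proof (rule integral_dominated_convergence[where w = "\<lambda>x. (f x)\<^sup>2"])
    show "AE x in circ. (\<lambda>n. ?F n x) \<longlonglongrightarrow> 0"
    proof (rule AE_I2, rule tendsto_eventually)
      fix x
      obtain N :: nat where "real N \<ge> \<bar>f x\<bar>"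
        using real_arch_simple by blast
      then show "\<forall>\<^sub>F n in sequentially. ?F n x = 0"
        by (intro eventually_sequentiallyI[of N]) auto
    qed
    show "AE x in circ. norm (?F n x) \<le> (f x)\<^sup>2" for n
      by (auto intro!: AE_I2 simp flip: abs_le_square_iff)
  qed (auto intro!: measurable_circ int)
  then have "\<forall>\<^sub>F n in sequentially. (LINT x|circ. ?F n x) < e"
    using \<open>e > 0\<close> by (simp add: order_tendstoD(2))
  then obtain n where "(LINT x|circ. ?F n x) < e"
    using eventually_happens' sequentially_bot by blast
  then show ?thesis
    by (intro that[of "real n"]) auto
qed

lemma continuous_approx:
  fixes f :: "real \<Rightarrow> real"
  assumes f [measurable]: "f \<in> borel_measurable borel"
    and bound: "\<And>x. \<bar>f x\<bar> \<le> M" and "e > 0"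
  obtains u where "continuous_on UNIV u" "u 0 = u (2 * pi)"
    "\<And>x. x \<in> {0..2 * pi} \<Longrightarrow> \<bar>u x\<bar> \<le> M"  "(LINT x|circ. (f x - u x)\<^sup>2) < e"
proof -
  \<comment> \<open>This notion of measurability supplies continuous functions converging to
    \<open>f\<close> off a negligible set, but without a common bound or control at the end points.
    Both are repaired below.\<close>
  have "f measurable_on UNIV"
    by (rule lebesgue_measurable_imp_measurable_on_real) (auto simp: measurable_completion)
  then obtain N g where N: "negligible N" and g: "\<And>n. continuous_on UNIV (g n)"
      "\<And>x. x \<notin> N \<Longrightarrow> (\<lambda>n. g n x) \<longlonglongrightarrow> f x" for n :: nat
    unfolding measurable_on_def by auto
  have M: "M \<ge> 0"
    using bound[of 0] by linarith
  \<comment> \<open>The cutoff vanishes at 0 and \<open>2 * pi\<close> and tends to 1 in between, so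
    it disturbs the limit at two points only. Clipping at \<open>M\<close> keeps the limit, as
    \<open>\<bar>f x\<bar> \<le> M\<close>, and provides a constant dominating function.\<close>
  define chi where "chi n x = min 1 (real n * x) * min 1 (real n * (2 * pi - x))" for n x
  define u where "u n x = chi n x * max (- M) (min M (g n x))" for n x
  have cont: "continuous_on UNIV (u n)" for n
    unfolding u_def chi_def by (intro continuous_intros g)
  have u_bound: "\<bar>u n x\<bar> \<le> M" if "x \<in> {0..2 * pi}" for n x
  proof -
    have "\<bar>chi n x\<bar> \<le> 1"
      using that unfolding chi_def abs_mult by (intro mult_le_one) auto
    then show ?thesis
      using M mult_mono[of "\<bar>chi n x\<bar>" 1 "\<bar>max (- M) (min M (g n x))\<bar>" M]
      unfolding u_def abs_mult by auto
  qed
  have min_lim: "(\<lambda>n. min 1 (real n * y)) \<longlonglongrightarrow> 1" if "y > 0" for y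
  proof (rule tendsto_eventually)
    obtain N :: nat where "1 / y \<le> real N"
      using real_arch_simple by blast
    then show "\<forall>\<^sub>F n in sequentially. min 1 (real n * y) = 1"
      using that by (intro eventually_sequentiallyI[of N])
        (simp add: min_def field_simps, smt (verit) mult_left_mono of_nat_mono)
  qed
  have u_lim: "(\<lambda>n. u n x) \<longlonglongrightarrow> f x" if "x \<notin> N" "0 < x" "x < 2 * pi" for x
  proof -
    have "(\<lambda>n. u n x) \<longlonglongrightarrow> 1 * 1 * max (- M) (min M (f x))"
      unfolding u_def chi_def using that
      by (intro tendsto_mult min_lim tendsto_max tendsto_min tendsto_const g(2)) auto
    then show ?thesis
      using bound[of x] by (simp add: abs_le_iff)
  qed
  have "(\<lambda>n. LINT x|circ. (f x - u n x)\<^sup>2) \<longlonglongrightarrow> (LINT x|circ. 0)"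
  proof (rule integral_dominated_convergence[where w = "\<lambda>x. (2 * M)\<^sup>2"])
    have "AE x in lebesgue. x \<notin> N"
      using N by (intro AE_not_in) (simp add: negligible_iff_null_sets)
    then have "AE x in lborel. x \<notin> N"
      by (simp add: AE_completion_iff)
    moreover have "AE x in lborel. x \<noteq> 0 \<and> x \<noteq> 2 * pi"
      using AE_lborel_singleton[of 0] AE_lborel_singleton[of "2 * pi"] by eventually_elim auto
    ultimately have "AE x in circ. x \<notin> N \<and> x \<noteq> 0 \<and> x \<noteq> 2 * pi"
      by (intro AE_circ_imp) auto
    then show "AE x in circ. (\<lambda>n. (f x - u n x)\<^sup>2) \<longlonglongrightarrow> 0"
      using AE_space_circ
    proof eventually_elim
      case (elim x)
      then have "(\<lambda>n. (f x - u n x)\<^sup>2) \<longlonglongrightarrow> (f x - f x)\<^sup>2"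
        by (intro tendsto_intros u_lim) auto
      then show ?case by simp
    qed
    show "AE x in circ. norm ((f x - u n x)\<^sup>2) \<le> (2 * M)\<^sup>2" for n
      using AE_space_circ
    proof eventually_elim
      case (elim x)
      then have "\<bar>f x - u n x\<bar> \<le> \<bar>2 * M\<bar>"
        using bound[of x] u_bound[of x n] by linarith
      then show ?case
        by (simp only: abs_le_square_iff) simp
    qed
    show "(\<lambda>x. (f x - u n x)\<^sup>2) \<in> borel_measurable circ" for n
      using borel_measurable_continuous_onI[OF cont] by (intro measurable_circ) measurable
  qed auto
  then have "\<forall>\<^sub>F n in sequentially. (LINT x|circ. (f x - u n x)\<^sup>2) < e"
    using \<open>e > 0\<close> by (simp add: order_tendstoD(2))
  then obtain n where "(LINT x|circ. (f x - u n x)\<^sup>2) < e"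
    using eventually_happens' sequentially_bot by blast
  moreover have "u n 0 = u n (2 * pi)"
    by (simp add: u_def chi_def)
  ultimately show ?thesis
    using cont u_bound by (intro that[of "u n"]) auto
qed

lemma trig_poly_dense:
  assumes f: "f \<in> L2T" and "e > 0"
  obtains p where "trig_poly p" "(LINT x|circ. (cmod (of_real (f x) - p x))\<^sup>2) < e"
proof -
  have f_meas [measurable]: "f \<in> borel_measurable borel"
    using f by (rule L2T_measurable)
  have f2: "integrable circ (\<lambda>x. (f x)\<^sup>2)"
    using f by (rule L2T_integrable_square)
  \<comment> \<open>Squaring a sum of three terms costs a factor 3: errors \<open>e / 9\<close>,
    \<open>e / 9\<close> and \<open>e / 18\<close> then total \<open>5 * e / 6 < e\<close>.\<close>
  obtain M where M: "M \<ge> 0" "(LINT x|circ. (f x - max (- M) (min M (f x)))\<^sup>2) < e / 9"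
    using truncation_approx[OF f_meas f2, of "e / 9"] \<open>e > 0\<close> by auto
  define v where "v x = max (- M) (min M (f x))" for x
  have v_meas [measurable]: "v \<in> borel_measurable borel"
    unfolding v_def by measurable
  have v_bound: "\<bar>v x\<bar> \<le> M" for x
    using M(1) by (auto simp: v_def)
  obtain u where u: "continuous_on UNIV u" "u 0 = u (2 * pi)"
      "\<And>x. x \<in> {0..2 * pi} \<Longrightarrow> \<bar>u x\<bar> \<le> M" "(LINT x|circ. (v x - u x)\<^sup>2) < e / 9"
    using continuous_approx[OF v_meas v_bound, of "e / 9"] \<open>e > 0\<close> by auto
  have u_meas [measurable]: "u \<in> borel_measurable borel"
    using u(1) by (rule borel_measurable_continuous_onI)
  \<comment> \<open>The uniform error is squared and integrated over length \<open>2 * pi\<close>,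
    and \<open>2 * pi * d\<^sup>2 = e / 18\<close>.\<close>
  define d where "d = sqrt (e / (36 * pi))"
  have d: "d > 0" "d\<^sup>2 = e / (36 * pi)"
    using \<open>e > 0\<close> by (auto simp: d_def)
  obtain p where p: "trig_poly p" "\<And>x. x \<in> {0..2 * pi} \<Longrightarrow> cmod (of_real (u x) - p x) < d"
    using trig_poly_uniform_approx[OF continuous_on_subset[OF u(1)] u(2) d(1)] by auto
  have p_meas [measurable]: "p \<in> borel_measurable borel"
    using p(1) by (rule measurable_trig_poly)
  have int1: "integrable circ (\<lambda>x. (f x - v x)\<^sup>2)"
  proof (rule Bochner_Integration.integrable_bound[OF f2])
    show "AE x in circ. norm ((f x - v x)\<^sup>2) \<le> norm ((f x)\<^sup>2)"
      using M(1) by (auto intro!: AE_I2 simp: v_def simp flip: abs_le_square_iff)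
  qed (auto intro!: measurable_circ)
  have int2: "integrable circ (\<lambda>x. (v x - u x)\<^sup>2)"
  proof (rule circ.integrable_const_bound)
    show "AE x in circ. norm ((v x - u x)\<^sup>2) \<le> (2 * M)\<^sup>2"
      using AE_space_circ
    proof eventually_elim
      case (elim x)
      then have "\<bar>v x - u x\<bar> \<le> \<bar>2 * M\<bar>"
        using v_bound[of x] u(3)[of x] by linarith
      then show ?case
        by (simp only: abs_le_square_iff) simp
    qed
  qed (auto intro!: measurable_circ)
  have up: "AE x in circ. (cmod (of_real (u x) - p x))\<^sup>2 \<le> d\<^sup>2"
    using AE_space_circ
  proof eventually_elim
    case (elim x)
    then show ?case
      using p(2)[of x] by (intro power_mono) auto
  qed
  have int3: "integrable circ (\<lambda>x. (cmod (of_real (u x) - p x))\<^sup>2)"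
    using up by (intro circ.integrable_const_bound[of _ "d\<^sup>2"]) (auto intro!: measurable_circ)
  have "(LINT x|circ. (cmod (of_real (u x) - p x))\<^sup>2) \<le> (LINT x|circ. d\<^sup>2)"
    using int3 up by (intro integral_mono_AE) auto
  also have "\<dots> = e / 18"
    using d(2) by (simp add: measure_circ)
  finally have 3: "(LINT x|circ. (cmod (of_real (u x) - p x))\<^sup>2) \<le> e / 18" .
  have ineq: "(cmod (of_real (f x) - p x))\<^sup>2 \<le>
      3 * ((f x - v x)\<^sup>2 + (v x - u x)\<^sup>2 + (cmod (of_real (u x) - p x))\<^sup>2)" for x
  proof -
    have three: "(a + b + c)\<^sup>2 \<le> 3 * (a\<^sup>2 + b\<^sup>2 + c\<^sup>2)" for a b c :: real
      using zero_le_power2[of "a - b"] zero_le_power2[of "b - c"] zero_le_power2[of "a - c"]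
      by (simp add: power2_eq_square algebra_simps)
    have "cmod (of_real (f x - v x) + of_real (v x - u x) + (of_real (u x) - p x)) \<le>
        cmod (of_real (f x - v x)) + cmod (of_real (v x - u x)) + cmod (of_real (u x) - p x)"
      by (intro norm_triangle_mono order_refl)
    then have "(cmod (of_real (f x) - p x))\<^sup>2 \<le>
        (\<bar>f x - v x\<bar> + \<bar>v x - u x\<bar> + cmod (of_real (u x) - p x))\<^sup>2"
      by (intro power_mono) (simp_all only: norm_of_real, simp_all)
    also note three
    finally show ?thesis by simp
  qed
  have int4: "integrable circ (\<lambda>x. (cmod (of_real (f x) - p x))\<^sup>2)"
    using trig_poly_distance(1)[OF f] trig_poly_sum_form[OF p(1)] by metis
  have "(LINT x|circ. (cmod (of_real (f x) - p x))\<^sup>2) \<le>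
      (LINT x|circ. 3 * ((f x - v x)\<^sup>2 + (v x - u x)\<^sup>2 + (cmod (of_real (u x) - p x))\<^sup>2))"
    by (intro integral_mono int4 integrable_mult_right Bochner_Integration.integrable_add
        int1 int2 int3 ineq)
  also have "\<dots> = 3 * ((LINT x|circ. (f x - v x)\<^sup>2) + (LINT x|circ. (v x - u x)\<^sup>2) +
      (LINT x|circ. (cmod (of_real (u x) - p x))\<^sup>2))"
    using int1 int2 int3 by simp
  also have "\<dots> < e"
  proof -
    have "3 * (a + b + c) < e" if "a < e / 9" "b < e / 9" "c \<le> e / 18" for a b c :: real
      using that \<open>e > 0\<close> by simp
    then show ?thesis
      using M(2) u(4) 3 unfolding v_def[symmetric] by blast
  qed
  finally show ?thesis
    using p(1) that by blast
qed

text \<open>By \<open>trig_poly_distance\<close>, the squared norm of \<open>f\<close> is at most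
  the sum of its squared coefficients over \<open>A\<close> plus the normalised squared distance to
  a trigonometric polynomial with frequencies in \<open>A\<close>; density makes the latter
  small.\<close>

lemma L2norm_le_of_fourier_sums:
  assumes f: "f \<in> L2T"
    and B: "\<And>A. finite A \<Longrightarrow> (\<Sum>k\<in>A. (cmod (fourier_coeff f k))\<^sup>2) \<le> B"
  shows "(L2norm f)\<^sup>2 \<le> B"
proof (rule field_le_epsilon)
  fix e :: real assume "e > 0"
  then obtain p where p: "trig_poly p" "(LINT x|circ. (cmod (of_real (f x) - p x))\<^sup>2) < 2 * pi * e"
    using trig_poly_dense[OF f, of "2 * pi * e"] by auto
  obtain A a where A: "finite A" "p = (\<lambda>x. \<Sum>k\<in>A. a k * cexp k x)"
    using trig_poly_sum_form[OF p(1)] .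
  have "(LINT x|circ. (cmod (of_real (f x) - p x))\<^sup>2) / (2 * pi) < e"
    using p(2) by (simp add: field_simps)
  moreover have "(\<Sum>k\<in>A. (cmod (a k - fourier_coeff f k))\<^sup>2) \<ge> 0"
    by (intro sum_nonneg) auto
  ultimately show "(L2norm f)\<^sup>2 \<le> B + e"
    using trig_poly_distance(2)[OF f A(1), of a] B[OF A(1)] unfolding A(2) by linarith
qed

subsection \<open>Translations and convolutions\<close>

lemma space_circ [simp]: "space circ = {0..2 * pi}"
  by (simp add: circ_def space_restrict_space)

text \<open>Half-open intervals split disjointly at a cut point, which the translation argument
  requires; the lost point 0 is a null set.\<close>

lemma
  fixes f :: "real \<Rightarrow> 'a::{banach, second_countable_topology}"
  shows integrable_circ_Ioc: "integrable circ f \<longleftrightarrow>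
      integrable lborel (\<lambda>x. indicator {0<..2 * pi} x *\<^sub>R f x)" (is ?thesis1)
    and integral_circ_Ioc: "(LINT x|circ. f x) = (LINT x|lborel. indicator {0<..2 * pi} x *\<^sub>R f x)"
      (is ?thesis2)
proof -
  show ?thesis1
    unfolding set_integrable_circ[symmetric] set_integrable_def
    by (rule integrable_discrete_difference[of "{0}"]) (auto simp: indicator_def)
  show ?thesis2
    unfolding set_integral_circ[symmetric] set_lebesgue_integral_def
    by (rule integral_discrete_difference[of "{0}"]) (auto simp: indicator_def)
qed

lemma per2pi_shift:
  fixes G :: "real \<Rightarrow> 'a::{banach, second_countable_topology}"
  assumes per: "per2pi G" and int: "integrable circ G" and a: "a \<in> {0..2 * pi}"
  shows "integrable circ (\<lambda>x. G (x + a))" "(LINT x|circ. G (x + a)) = (LINT x|circ. G x)"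
proof -
  define F where "F x = indicator {a<..2 * pi} x *\<^sub>R G x" for x
  define H where "H x = indicator {0<..a} x *\<^sub>R G x" for x
  have J: "set_integrable lborel {0<..2 * pi} G"
    using int unfolding integrable_circ_Ioc set_integrable_def .
  have F: "integrable lborel F" and H: "integrable lborel H"
    unfolding F_def H_def set_integrable_def[symmetric]
    using a by (auto intro!: set_integrable_subset[OF J])
  have sum1: "indicator {0<..2 * pi} x *\<^sub>R G x = F x + H x" for x
    using a by (auto simp: F_def H_def indicator_def)
  \<comment> \<open>For \<open>x\<close> up to \<open>2 * pi - a\<close> the point
    \<open>x + a\<close> lies in the upper piece \<open>F\<close>; beyond that, going back one
    period lands in the lower piece \<open>H\<close>.\<close>
  have sum2: "indicator {0<..2 * pi} x *\<^sub>R G (x + a) = F (a + 1 * x) + H ((a - 2 * pi) + 1 * x)" for x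
    using a per[unfolded per2pi_def, rule_format, of "a - 2 * pi + x"]
    by (auto simp: F_def H_def indicator_def algebra_simps)
  have F': "integrable lborel (\<lambda>x. F (a + 1 * x))"
      "(LINT x|lborel. F (a + 1 * x)) = (LINT x|lborel. F x)"
    using lborel_integrable_real_affine[OF F, of 1 a] lborel_integral_real_affine[of 1 F a] by simp_all
  have H': "integrable lborel (\<lambda>x. H ((a - 2 * pi) + 1 * x))"
      "(LINT x|lborel. H ((a - 2 * pi) + 1 * x)) = (LINT x|lborel. H x)"
    using lborel_integrable_real_affine[OF H, of 1 "a - 2 * pi"]
      lborel_integral_real_affine[of 1 H "a - 2 * pi"] by simp_all
  show "integrable circ (\<lambda>x. G (x + a))"
    unfolding integrable_circ_Ioc sum2 using F'(1) H'(1) by (rule Bochner_Integration.integrable_add)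
  have "(LINT x|circ. G (x + a)) = (LINT x|lborel. F x) + (LINT x|lborel. H x)"
    unfolding integral_circ_Ioc sum2 Bochner_Integration.integral_add[OF F'(1) H'(1)] F'(2) H'(2) ..
  also have "\<dots> = (LINT x|circ. G x)"
    unfolding integral_circ_Ioc sum1 Bochner_Integration.integral_add[OF F H] ..
  finally show "(LINT x|circ. G (x + a)) = (LINT x|circ. G x)" .
qed

lemma per2pi_diff: "per2pi G \<Longrightarrow> G (x - 2 * pi) = G x"
  using per2pi_def[of G] by (metis diff_add_cancel)

lemma per2pi_shift_diff:
  fixes G :: "real \<Rightarrow> 'a::{banach, second_countable_topology}"
  assumes per: "per2pi G" and int: "integrable circ G" and a: "a \<in> {0..2 * pi}"
  shows "integrable circ (\<lambda>x. G (x - a))" "(LINT x|circ. G (x - a)) = (LINT x|circ. G x)"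
proof -
  have eq: "G (x - a) = G (x + (2 * pi - a))" for x
    using per[unfolded per2pi_def, rule_format, of "x - a"] by (simp add: algebra_simps)
  show "integrable circ (\<lambda>x. G (x - a))" "(LINT x|circ. G (x - a)) = (LINT x|circ. G x)"
    unfolding eq using a by (auto intro!: per2pi_shift per int)
qed

lemma per2pi_reflect:
  fixes G :: "real \<Rightarrow> 'a::{banach, second_countable_topology}"
  assumes per: "per2pi G" and int: "integrable circ G" and a: "a \<in> {0..2 * pi}"
  shows "integrable circ (\<lambda>x. G (a - x))" "(LINT x|circ. G (a - x)) = (LINT x|circ. G x)"
proof -
  let ?J = "\<lambda>x. indicator {0..2 * pi} x *\<^sub>R G x"
  have J: "integrable lborel ?J"
    using int unfolding set_integrable_circ[symmetric] set_integrable_def .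
  have "G (- x) = G (2 * pi + (- 1) * x)" for x
    using per[unfolded per2pi_def, rule_format, of "- x"] by (simp add: algebra_simps)
  \<comment> \<open>The closed interval, unlike the half-open one, is mapped onto itself by the
    reflection from \<open>x\<close> to \<open>2 * pi - x\<close>.\<close>
  then have eq: "indicator {0..2 * pi} x *\<^sub>R G (- x) = ?J (2 * pi + (- 1) * x)" for x
    by (auto simp: indicator_def)
  have refl: "integrable circ (\<lambda>x. G (- x))" "(LINT x|circ. G (- x)) = (LINT x|circ. G x)"
    unfolding set_integrable_circ[symmetric] set_integral_circ[symmetric] set_integrable_def
      set_lebesgue_integral_def eq
    using lborel_integrable_real_affine[OF J, of "- 1" "2 * pi"]
      lborel_integral_real_affine[of "- 1" ?J "2 * pi"] by simp_all
  have "per2pi (\<lambda>x. G (- x))"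
    using per2pi_diff[OF per] by (auto simp: per2pi_def)
  from per2pi_shift_diff[OF this refl(1) a] refl(2)
  show "integrable circ (\<lambda>x. G (a - x))" "(LINT x|circ. G (a - x)) = (LINT x|circ. G x)"
    by simp_all
qed

section \<open>Square integrable functions: closure properties and rules for coefficients\<close>

lemma L2T_I:
  assumes "per2pi f" "f \<in> borel_measurable borel" "integrable circ (\<lambda>x. (f x)\<^sup>2)"
  shows "f \<in> L2T"
  using assms by (simp add: L2T_def set_integrable_circ)

lemma L2T_zero: "(\<lambda>x. 0) \<in> L2T"
  by (rule L2T_I) (auto simp: per2pi_def)

lemma L2T_cmult: "f \<in> L2T \<Longrightarrow> (\<lambda>x. c * f x) \<in> L2T"
  using L2T_per2pi[of f] L2T_measurable[of f] L2T_integrable_square[of f]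
  by (intro L2T_I) (auto simp: per2pi_def power_mult_distrib)

lemma power2_add_le: "(a + b)\<^sup>2 \<le> 2 * a\<^sup>2 + 2 * b\<^sup>2" for a b :: real
  using zero_le_power2[of "a - b"] by (simp add: power2_eq_square algebra_simps)

lemma L2T_add:
  assumes f: "f \<in> L2T" and g: "g \<in> L2T"
  shows "(\<lambda>x. f x + g x) \<in> L2T"
proof (rule L2T_I)
  show "per2pi (\<lambda>x. f x + g x)"
    using L2T_per2pi[OF f] L2T_per2pi[OF g] by (simp add: per2pi_def)
  show meas: "(\<lambda>x. f x + g x) \<in> borel_measurable borel"
    by (intro borel_measurable_add L2T_measurable f g)
  show "integrable circ (\<lambda>x. (f x + g x)\<^sup>2)"
  proof (rule Bochner_Integration.integrable_bound)
    show "integrable circ (\<lambda>x. 2 * (f x)\<^sup>2 + 2 * (g x)\<^sup>2)"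
      using L2T_integrable_square[OF f] L2T_integrable_square[OF g] by simp
    show "AE x in circ. norm ((f x + g x)\<^sup>2) \<le> norm (2 * (f x)\<^sup>2 + 2 * (g x)\<^sup>2)"
      using power2_add_le by auto
  qed (use meas in \<open>auto intro!: measurable_circ\<close>)
qed

lemma L2T_sum: "(\<And>i. i \<in> A \<Longrightarrow> f i \<in> L2T) \<Longrightarrow> (\<lambda>x. \<Sum>i\<in>A. f i x) \<in> L2T"
  by (induction A rule: infinite_finite_induct) (auto intro: L2T_zero L2T_add)

lemma L2T_diff: "f \<in> L2T \<Longrightarrow> g \<in> L2T \<Longrightarrow> (\<lambda>x. f x - g x) \<in> L2T"
  using L2T_add[of f "\<lambda>x. (- 1) * g x"] L2T_cmult[of g "- 1"] by simp

lemma L2T_translate: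
  assumes "f \<in> L2T" "a \<in> {0..2 * pi}"
  shows "(\<lambda>x. f (x - a)) \<in> L2T"
proof (rule L2T_I)
  have per: "per2pi f"
    using assms(1) by (rule L2T_per2pi)
  then show "per2pi (\<lambda>x. f (x - a))"
    by (simp add: per2pi_def diff_add_eq[symmetric])
  show "(\<lambda>x. f (x - a)) \<in> borel_measurable borel"
    using L2T_measurable[OF assms(1)] by measurable
  have "per2pi (\<lambda>x. (f x)\<^sup>2)"
    using per by (simp add: per2pi_def)
  then show "integrable circ (\<lambda>x. (f (x - a))\<^sup>2)"
    by (rule per2pi_shift_diff(1)[OF _ L2T_integrable_square[OF assms(1)] assms(2)])
qed

lemma integrable_fourier:
  "f \<in> L2T \<Longrightarrow> integrable circ (\<lambda>x. complex_of_real (f x) * cexp k x)"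
  by (intro integrable_cexp_mult integrable_of_real L2T_integrable)

lemma fourier_coeff_cmult: "fourier_coeff (\<lambda>x. c * f x) k = c * fourier_coeff f k"
  by (simp add: fourier_coeff_circ mult.assoc)

lemma fourier_coeff_diff:
  "f \<in> L2T \<Longrightarrow> g \<in> L2T \<Longrightarrow>
    fourier_coeff (\<lambda>x. f x - g x) k = fourier_coeff f k - fourier_coeff g k"
  by (simp add: fourier_coeff_circ left_diff_distrib integrable_fourier diff_divide_distrib)

lemma fourier_coeff_sum:
  "(\<And>i. i \<in> A \<Longrightarrow> f i \<in> L2T) \<Longrightarrow>
    fourier_coeff (\<lambda>x. \<Sum>i\<in>A. f i x) k = (\<Sum>i\<in>A. fourier_coeff (f i) k)"
  by (simp add: fourier_coeff_circ sum_distrib_right integrable_fourier sum_divide_distrib)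

lemma fourier_coeff_translate:
  assumes f: "f \<in> L2T" and a: "a \<in> {0..2 * pi}"
  shows "fourier_coeff (\<lambda>x. f (x - a)) k = cexp (- k) a * fourier_coeff f k"
proof -
  let ?G = "\<lambda>x. complex_of_real (f x) * cexp (- k) x"
  have "per2pi ?G"
    using L2T_per2pi[OF f] per2pi_cexp[of "- k"] by (simp add: per2pi_def)
  note shift = per2pi_shift_diff(2)[OF this integrable_fourier[OF f] a]
  have eq: "complex_of_real (f (x - a)) * cexp (- k) x = cexp (- k) a * ?G (x - a)" for x
    using cexp_add[of "- k" "x - a" a] by simp
  show ?thesis
    unfolding fourier_coeff_circ eq integral_mult_right_zero shift by simp
qed

text \<open>Fubini's theorem after splitting the character as
  \<open>cexp (- k) y * cexp (- k) (x - y)\<close>: by translation invariance, the integral over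
  \<open>x\<close> of the factor in \<open>x - y\<close> does not depend on
  \<open>y\<close>.\<close>

lemma fourier_coeff_conv:
  assumes f: "f \<in> L2T" and phi: "\<phi> \<in> L2T" and g: "g \<in> L2T"
    and eq: "AE x in lborel. f x = conv \<phi> g x"
  shows "fourier_coeff f k = fourier_coeff \<phi> k * fourier_coeff g k"
proof -
  note [measurable] = L2T_measurable[OF g]
  have id_meas: "(\<lambda>x. x) \<in> borel_measurable circ"
    by (rule measurable_circ) simp
  have fst_meas [measurable]: "fst \<in> borel_measurable (circ \<Otimes>\<^sub>M circ)"
    by (rule measurable_compose[OF measurable_fst id_meas])
  have snd_meas [measurable]: "snd \<in> borel_measurable (circ \<Otimes>\<^sub>M circ)"
    by (rule measurable_compose[OF measurable_snd id_meas])
  have phi_meas [measurable]: "(\<lambda>z. \<phi> (fst z)) \<in> borel_measurable (circ \<Otimes>\<^sub>M circ)"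
    by (rule measurable_compose[OF fst_meas L2T_measurable[OF phi]])
  have g_meas [measurable]: "(\<lambda>z. g (snd z - fst z)) \<in> borel_measurable (circ \<Otimes>\<^sub>M circ)"
    by (rule measurable_compose[OF _ L2T_measurable[OF g]])
      (intro borel_measurable_diff fst_meas snd_meas)
  have e_meas [measurable]: "(\<lambda>z. cexp (- k) (snd z)) \<in> borel_measurable (circ \<Otimes>\<^sub>M circ)"
    by (rule measurable_compose[OF snd_meas measurable_cexp])
  define F where "F = (\<lambda>z. complex_of_real (\<phi> (fst z) * g (snd z - fst z)) * cexp (- k) (snd z))"
  have F_meas: "F \<in> borel_measurable (circ \<Otimes>\<^sub>M circ)"
    unfolding F_def
    by (intro borel_measurable_times e_meas
        measurable_compose[OF _ borel_measurable_of_real] phi_meas g_meas)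
  let ?G = "\<lambda>x. complex_of_real (g x) * cexp (- k) x"
  have per_g: "per2pi (\<lambda>x. norm (g x))" and per_G: "per2pi ?G"
    using L2T_per2pi[OF g] per2pi_cexp[of "- k"] by (simp_all add: per2pi_def)
  have int_g: "integrable circ (\<lambda>x. norm (g x))"
    using L2T_integrable[OF g] by (rule integrable_norm)
  note int_G = integrable_fourier[OF g, of "- k"]
  have F_eq: "F (y, x) = complex_of_real (\<phi> y) * cexp (- k) y * ?G (x - y)" for x y
    using cexp_add[of "- k" "x - y" y] by (simp add: F_def)
  \<comment> \<open>By translation invariance the iterated integral of the norm is the product of
    the integrals of \<open>\<bar>\<phi>\<bar>\<close> and \<open>\<bar>g\<bar>\<close>, both
    finite.\<close>
  have "integrable (circ \<Otimes>\<^sub>M circ) F"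
  proof (rule circ2.Fubini_integrable[OF F_meas])
    have "(LINT x|circ. norm (F (y, x))) = norm (\<phi> y) * (LINT x|circ. norm (g x))"
      if "y \<in> space circ" for y
      using per2pi_shift_diff(2)[OF per_g int_g, of y] that
      by (simp add: F_def norm_mult)
    moreover have "integrable circ (\<lambda>y. norm (\<phi> y) * (LINT x|circ. norm (g x)))"
      by (intro integrable_mult_left integrable_norm L2T_integrable phi)
    ultimately show "integrable circ (\<lambda>y. LINT x|circ. norm (F (y, x)))"
      by (subst Bochner_Integration.integrable_cong[OF refl]) auto
    show "AE y in circ. integrable circ (\<lambda>x. F (y, x))"
      unfolding F_eq using per2pi_shift_diff(1)[OF per_G int_G]
      by (intro AE_I2 integrable_mult_right) auto
  qed
  then have Fub: "(LINT x|circ. (LINT y|circ. F (y, x))) = (LINT y|circ. (LINT x|circ. F (y, x)))"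
    using circ2.Fubini_integral[of "\<lambda>y x. F (y, x)"] by simp
  have "(LINT y|circ. (LINT x|circ. F (y, x))) =
      (LINT y|circ. complex_of_real (\<phi> y) * cexp (- k) y * (LINT x|circ. ?G x))"
    using per2pi_shift_diff(2)[OF per_G int_G]
    by (intro Bochner_Integration.integral_cong refl) (simp add: F_eq)
  also have "\<dots> = (2 * pi * fourier_coeff \<phi> k) * (2 * pi * fourier_coeff g k)"
    by (simp add: fourier_coeff_circ)
  finally have R: "(LINT x|circ. (LINT y|circ. F (y, x))) =
      (2 * pi * fourier_coeff \<phi> k) * (2 * pi * fourier_coeff g k)"
    unfolding Fub .
  \<comment> \<open>True at every \<open>x\<close>: where the integrand is not integrable in
    \<open>y\<close>, both sides take the default value 0.\<close>
  have inner: "(LINT y|circ. F (y, x)) = 2 * pi * (complex_of_real (conv \<phi> g x) * cexp (- k) x)" for x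
    unfolding F_def conv_def set_integral_circ
    by (simp add: integral_complex_of_real flip: of_real_mult)
  \<comment> \<open>Measurability of \<open>conv \<phi> g\<close> comes from that of a parameter
    integral, via \<open>inner\<close>. It is required for replacing \<open>f\<close> by the
    convolution under the integral.\<close>
  have "(\<lambda>x. LINT y|circ. F (y, x)) \<in> borel_measurable circ"
  proof (rule circ.borel_measurable_lebesgue_integral)
    show "(\<lambda>(x, y). F (y, x)) \<in> borel_measurable (circ \<Otimes>\<^sub>M circ)"
      using measurable_pair_swap[OF F_meas] by (simp add: case_prod_beta')
  qed
  then have "(\<lambda>x. (2 * pi * (complex_of_real (conv \<phi> g x) * cexp (- k) x)) / (2 * pi))
      \<in> borel_measurable circ"
    unfolding inner by (intro borel_measurable_divide) auto
  then have meas: "(\<lambda>x. complex_of_real (conv \<phi> g x) * cexp (- k) x) \<in> borel_measurable circ"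
    by simp
  have "(LINT x|circ. complex_of_real (f x) * cexp (- k) x) =
      (LINT x|circ. complex_of_real (conv \<phi> g x) * cexp (- k) x)"
  proof (rule integral_cong_AE[OF _ meas])
    show "(\<lambda>x. complex_of_real (f x) * cexp (- k) x) \<in> borel_measurable circ"
      using integrable_fourier[OF f] by (rule borel_measurable_integrable)
    have "AE x in circ. f x = conv \<phi> g x"
      using eq by (rule AE_circ_imp)
    then show "AE x in circ. complex_of_real (f x) * cexp (- k) x =
        complex_of_real (conv \<phi> g x) * cexp (- k) x"
      by eventually_elim simp
  qed
  also have "2 * pi * \<dots> = (2 * pi * fourier_coeff \<phi> k) * (2 * pi * fourier_coeff g k)"
    using R unfolding inner by simp
  finally show ?thesis
    unfolding fourier_coeff_circ[of f] by simp
qed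

subsection \<open>The sampling operator\<close>

lemma delta_range: "l \<le> 2 * m \<Longrightarrow> delta m * real l \<in> {0..2 * pi}"
proof -
  assume "l \<le> 2 * m"
  then have "real l \<le> 2 * real m + 1"
    by linarith
  then have "2 * pi * real l \<le> 2 * pi * (2 * real m + 1)"
    by (intro mult_left_mono) auto
  then show ?thesis
    by (simp add: delta_def field_simps)
qed

lemma cexp_power: "cexp k x ^ n = cexp k (x * real n)"
  by (simp add: cexp_def exp_of_nat_mult[symmetric] mult_ac)

text \<open>Discrete orthogonality: the ratio \<open>cexp n (delta m)\<close> is a root of unity
  whose order divides \<open>2 * m + 1\<close>, so the geometric sum vanishes unless the ratio is
  1.\<close>

lemma sum_cexp_nodes:
  "(\<Sum>l\<in>{0..2 * m}. cexp n (delta m * real l)) =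
     (if (2 * int m + 1) dvd n then 2 * of_nat m + 1 else 0)"
proof -
  define N where "N = 2 * int m + 1"
  have N: "N \<noteq> 0"
    unfolding N_def by linarith
  have delta: "delta m = 2 * pi / of_int N"
    by (simp add: delta_def N_def)
  have one_iff: "cexp n (delta m) = 1 \<longleftrightarrow> N dvd n"
  proof
    assume "N dvd n"
    then obtain q where "n = N * q" ..
    then have "cexp n (delta m) = cexp q (2 * pi)"
      using N by (simp add: cexp_def delta mult.assoc)
    then show "cexp n (delta m) = 1" by simp
  next
    assume "cexp n (delta m) = 1"
    then obtain q :: int where "of_int n * delta m = of_int (2 * q) * pi"
      unfolding cexp_def exp_eq_1 by auto
    then have "real_of_int n = of_int (N * q)"
      using N by (simp add: delta field_simps)
    then show "N dvd n"
      by (simp only: of_int_eq_iff) simp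
  qed
  have pow: "cexp n (delta m) ^ Suc (2 * m) = 1"
  proof -
    have "delta m * real (Suc (2 * m)) = 2 * pi"
      by (simp add: delta_def field_simps)
    then show ?thesis
      unfolding cexp_power by simp
  qed
  have "(\<Sum>l\<in>{0..2 * m}. cexp n (delta m * real l)) = (\<Sum>l<Suc (2 * m). cexp n (delta m) ^ l)"
    by (intro sum.cong) (auto simp: cexp_power)
  also have "\<dots> = (if N dvd n then 2 * of_nat m + 1 else 0)"
  proof (cases "N dvd n")
    case True
    then show ?thesis
      using one_iff by simp
  next
    case False
    then have "cexp n (delta m) \<noteq> 1"
      using one_iff by simp
    then show ?thesis
      using False by (subst geometric_sum) (simp_all only: pow if_False, simp_all)
  qed
  finally show ?thesis
    by (simp add: N_def)
qed

section \<open>Residues modulo \<open>2 * m + 1\<close> and blocks of frequencies\<close>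

lemma kprime_eqI:
  assumes "k' \<in> {- int m..int m}" "(2 * int m + 1) dvd (k - k')"
  shows "kprime m k = k'"
  unfolding kprime_def
proof (rule the_equality)
  fix j assume j: "j \<in> {- int m..int m} \<and> (2 * int m + 1) dvd (k - j)"
  have "(2 * int m + 1) dvd (k - k') - (k - j)"
    by (rule dvd_diff[OF assms(2) conjunct2[OF j]])
  then have "(2 * int m + 1) dvd (j - k')"
    by simp
  \<comment> \<open>Two points of \<open>{- m..m}\<close> are at most \<open>2 * m\<close> apart,
    less than the modulus.\<close>
  moreover have "\<bar>j - k'\<bar> < 2 * int m + 1"
    using j assms by auto
  ultimately show "j = k'"
    using dvd_imp_le_int[of "j - k'" "2 * int m + 1"] by fastforce
qed (use assms in auto)

text \<open>The \<open>j\<close> whose block \<open>I_block m j\<close> contains \<open>k\<close>: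
  adding \<open>m\<close> turns blocks centred at multiples of \<open>2 * m + 1\<close> into
  intervals starting there.\<close>

definition block_index :: "nat \<Rightarrow> int \<Rightarrow> int" where
  "block_index m k = (k + int m) div (2 * int m + 1)"

lemma kprime_block_index: "kprime m k = k - (2 * int m + 1) * block_index m k"
  and kprime_range: "kprime m k \<in> {- int m..int m}"
proof -
  let ?r = "k - (2 * int m + 1) * block_index m k"
  have "?r = (k + int m) mod (2 * int m + 1) - int m"
    using mult_div_mod_eq[of "2 * int m + 1" "k + int m"] unfolding block_index_def by linarith
  then have "?r \<in> {- int m..int m}"
    using pos_mod_bound[of "2 * int m + 1" "k + int m"] pos_mod_sign[of "2 * int m + 1" "k + int m"]
    by auto
  then show "kprime m k = ?r" "kprime m k \<in> {- int m..int m}"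
    using kprime_eqI[of ?r m k] by simp_all
qed

lemma kprime_dvd_iff:
  assumes "n \<in> {- int m..int m}"
  shows "(2 * int m + 1) dvd (n - k) \<longleftrightarrow> n = kprime m k"
proof
  assume "(2 * int m + 1) dvd (n - k)"
  then show "n = kprime m k"
    using kprime_eqI[OF assms, of k] by (simp add: dvd_diff_commute)
qed (simp add: kprime_block_index)

lemma kprime_id: "\<bar>k\<bar> \<le> int m \<Longrightarrow> kprime m k = k"
  by (rule kprime_eqI) auto

lemma block_index_nonzero: "\<bar>k\<bar> > int m \<Longrightarrow> block_index m k \<noteq> 0"
  using kprime_block_index[of m k] kprime_range[of m k] by auto

lemma gamma_le_Gamma: "cmod (gamma_coeff lam bet m k) \<le> Gamma_max lam bet m (block_index m k)"
proof -
  have "k \<in> I_block m (block_index m k)"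
    using kprime_block_index[of m k] kprime_range[of m k] by (simp add: I_block_def)
  then show ?thesis
    unfolding Gamma_max_def by (intro Max_ge) (auto simp: I_block_def)
qed

text \<open>An identity at every point, because \<open>V_op\<close> gets sampled: the samples depend
  on \<open>g\<close> only through its coefficients. The hypothesis \<open>H\<close> carries the
  fact that the polynomial is real-valued; the theorem takes it from
  \<open>of_real_H_poly\<close>.\<close>

lemma V_op_eq:
  assumes H: "\<And>x. complex_of_real (H_poly lam bet m x) = (\<Sum>k\<in>{- int m..int m}. alpha lam bet k * cexp k x)"
    and g: "g \<in> L2T" and t: "t \<in> {0..2 * pi}"
  shows "complex_of_real (V_op lam bet m g t) =
     (\<Sum>k\<in>{- int m..int m}. alpha lam bet k * fourier_coeff g k * cexp k t)"
proof -
  have term_y: "integrable circ (\<lambda>y. cexp k y * complex_of_real (g (t - y)))"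
      "(LINT y|circ. cexp k y * complex_of_real (g (t - y))) = 2 * pi * fourier_coeff g k * cexp k t"
      for k
  proof -
    let ?G = "\<lambda>x. complex_of_real (g x) * cexp (- k) x"
    have per: "per2pi ?G"
      using L2T_per2pi[OF g] per2pi_cexp[of "- k"] by (simp add: per2pi_def)
    have eq: "cexp k y * complex_of_real (g (t - y)) = cexp k t * ?G (t - y)" for y
    proof -
      have "cexp k t * cexp (- k) (t - y) = cexp k y"
        using cexp_add[of "- k" t "- y"] by (simp add: cexp_uminus mult.assoc[symmetric] cexp_mult)
      then show ?thesis by (simp add: mult_ac)
    qed
    note refl = per2pi_reflect[OF per integrable_fourier[OF g] t]
    show "integrable circ (\<lambda>y. cexp k y * complex_of_real (g (t - y)))"
      unfolding eq by (intro integrable_mult_right refl(1))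
    show "(LINT y|circ. cexp k y * complex_of_real (g (t - y))) = 2 * pi * fourier_coeff g k * cexp k t"
      unfolding eq integral_mult_right_zero refl(2) by (simp add: fourier_coeff_circ)
  qed
  have "complex_of_real (V_op lam bet m g t) =
      (LINT y|circ. complex_of_real (H_poly lam bet m y * g (t - y))) / (2 * pi)"
    by (simp only: V_op_def conv_def set_integral_circ integral_complex_of_real of_real_divide)
  also have "(\<lambda>y. complex_of_real (H_poly lam bet m y * g (t - y))) =
      (\<lambda>y. \<Sum>k\<in>{- int m..int m}. alpha lam bet k * (cexp k y * complex_of_real (g (t - y))))"
    by (simp add: H sum_distrib_right mult.assoc)
  also have "(LINT y|circ. (\<Sum>k\<in>{- int m..int m}. alpha lam bet k *
        (cexp k y * complex_of_real (g (t - y))))) =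
      (\<Sum>k\<in>{- int m..int m}. alpha lam bet k * (2 * pi * fourier_coeff g k * cexp k t))"
    by (subst Bochner_Integration.integral_sum)
      (simp_all only: integrable_mult_right term_y integral_mult_right_zero)
  also have "\<dots> / (2 * pi) = (\<Sum>k\<in>{- int m..int m}. alpha lam bet k * fourier_coeff g k * cexp k t)"
    by (simp add: sum_divide_distrib mult.assoc)
  finally show ?thesis .
qed

lemma Q_op_L2T:
  assumes "\<phi>bet \<in> L2T"
  shows "Q_op lam bet \<phi>lam \<phi>bet m f \<in> L2T"
proof -
  have "(\<lambda>x. 1 / (2 * real m + 1) *
     (\<Sum>l\<in>{0..2 * m}. V_op lam bet m (deconv \<phi>lam f) (delta m * real l)
                        * \<phi>bet (x - delta m * real l))) \<in> L2T"
    by (intro L2T_cmult L2T_sum L2T_translate assms delta_range) auto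
  then show ?thesis
    by (simp only: Q_op_def[abs_def])
qed

text \<open>After interchanging the finite sums, frequency \<open>n\<close> is weighted by the node
  sum of \<open>cexp (n - k)\<close>. In \<open>{- m..m}\<close> only \<open>n = kprime m k\<close>
  survives, and its factor \<open>2 * m + 1\<close> cancels the averaging.\<close>

lemma fourier_coeff_Q_op:
  assumes H: "\<And>x. complex_of_real (H_poly lam bet m x) = (\<Sum>k\<in>{- int m..int m}. alpha lam bet k * cexp k x)"
    and phi: "\<phi>bet \<in> L2T" and bet: "fourier_coeff \<phi>bet k = inverse (bet k)"
    and g: "deconv \<phi>lam f \<in> L2T"
  shows "fourier_coeff (Q_op lam bet \<phi>lam \<phi>bet m f) k =
    gamma_coeff lam bet m k * fourier_coeff (deconv \<phi>lam f) (kprime m k)"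
proof -
  let ?g = "deconv \<phi>lam f" and ?N = "2 * complex_of_nat m + 1"
  let ?V = "\<lambda>l. V_op lam bet m ?g (delta m * real l)"
  have N: "?N \<noteq> 0"
    using of_nat_neq_0[of "2 * m", where 'a = complex] by (simp add: add.commute)
  have "fourier_coeff (Q_op lam bet \<phi>lam \<phi>bet m f) k = 1 / ?N *
      (\<Sum>l\<in>{0..2 * m}. of_real (?V l) * (cexp (- k) (delta m * real l) * inverse (bet k)))"
  proof -
    have "fourier_coeff (\<lambda>x. \<Sum>l\<in>{0..2 * m}. ?V l * \<phi>bet (x - delta m * real l)) k =
        (\<Sum>l\<in>{0..2 * m}. fourier_coeff (\<lambda>x. ?V l * \<phi>bet (x - delta m * real l)) k)"
      by (intro fourier_coeff_sum L2T_cmult L2T_translate phi delta_range) auto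
    also have "\<dots> = (\<Sum>l\<in>{0..2 * m}. of_real (?V l) * (cexp (- k) (delta m * real l) * inverse (bet k)))"
      by (intro sum.cong refl)
        (simp add: fourier_coeff_cmult fourier_coeff_translate[OF phi delta_range] bet)
    finally show ?thesis
      unfolding Q_op_def[abs_def] fourier_coeff_cmult by simp
  qed
  also have "(\<Sum>l\<in>{0..2 * m}. of_real (?V l) * (cexp (- k) (delta m * real l) * inverse (bet k))) =
      (\<Sum>l\<in>{0..2 * m}. \<Sum>n\<in>{- int m..int m}.
        alpha lam bet n * fourier_coeff ?g n * inverse (bet k) * cexp (n - k) (delta m * real l))"
  proof (intro sum.cong refl)
    fix l assume "l \<in> {0..2 * m}"
    then have "of_real (?V l) = (\<Sum>n\<in>{- int m..int m}. alpha lam bet n * fourier_coeff ?g n *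
        cexp n (delta m * real l))"
      by (intro V_op_eq[OF H g] delta_range) auto
    then show "of_real (?V l) * (cexp (- k) (delta m * real l) * inverse (bet k)) =
        (\<Sum>n\<in>{- int m..int m}. alpha lam bet n * fourier_coeff ?g n * inverse (bet k) *
          cexp (n - k) (delta m * real l))"
      by (simp only: sum_distrib_right sum_distrib_left cexp_diff mult_ac)
  qed
  also have "\<dots> = (\<Sum>n\<in>{- int m..int m}. alpha lam bet n * fourier_coeff ?g n * inverse (bet k) *
      (\<Sum>l\<in>{0..2 * m}. cexp (n - k) (delta m * real l)))"
    unfolding sum_distrib_left by (rule sum.swap)
  also have "\<dots> = (\<Sum>n\<in>{- int m..int m}. if n = kprime m k
      then alpha lam bet n * fourier_coeff ?g n * inverse (bet k) * ?N else 0)"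
    unfolding sum_cexp_nodes by (intro sum.cong refl) (simp add: kprime_dvd_iff)
  also have "\<dots> = gamma_coeff lam bet m k * fourier_coeff ?g (kprime m k) * ?N"
    using kprime_range[of m k] by (subst sum.delta) (auto simp: gamma_coeff_def)
  finally show ?thesis
    using N by simp
qed

text \<open>Sending \<open>k\<close> to its block and residue is injective, so by nonnegativity the
  sum is at most the one over a full rectangle, which factors. Only finitely many blocks meet
  \<open>A\<close>, hence bounds for finite \<open>J\<close> suffice.\<close>

lemma sum_over_blocks:
  fixes a b :: "int \<Rightarrow> real"
  assumes A: "finite A" "\<And>k. k \<in> A \<Longrightarrow> \<bar>k\<bar> > int m"
    and pos: "\<And>j. a j \<ge> 0" "\<And>n. b n \<ge> 0"
    and Sa: "\<And>J. finite J \<Longrightarrow> 0 \<notin> J \<Longrightarrow> sum a J \<le> S" and Sb: "sum b {- int m..int m} \<le> T"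
  shows "(\<Sum>k\<in>A. a (block_index m k) * b (kprime m k)) \<le> S * T"
proof -
  define J where "J = block_index m ` A"
  have J: "finite J" "0 \<notin> J"
    using A block_index_nonzero by (auto simp: J_def)
  let ?h = "\<lambda>k. (block_index m k, kprime m k)"
  have inj: "inj_on ?h A"
  proof (rule inj_onI)
    fix k l assume "?h k = ?h l"
    then have eq: "block_index m k = block_index m l" "kprime m k = kprime m l"
      by auto
    show "k = l"
      using kprime_block_index[of m k] kprime_block_index[of m l] unfolding eq by linarith
  qed
  have "(\<Sum>k\<in>A. a (block_index m k) * b (kprime m k)) = (\<Sum>(j, n)\<in>?h ` A. a j * b n)"
    by (simp add: sum.reindex[OF inj])
  also have "\<dots> \<le> (\<Sum>(j, n)\<in>J \<times> {- int m..int m}. a j * b n)"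
    using J kprime_range pos by (intro sum_mono2) (auto simp: J_def)
  also have "\<dots> = sum a J * sum b {- int m..int m}"
    by (simp add: sum_product sum.cartesian_product)
  \<comment> \<open>The empty set in \<open>Sa\<close> gives \<open>0 \<le> S\<close>, needed for
    monotonicity of the product.\<close>
  also have "\<dots> \<le> S * T"
    using Sa[of "{}"] pos by (intro mult_mono Sa J Sb sum_nonneg) auto
  finally show ?thesis .
qed

text \<open>Replaces the extended value by one real number dominating both parts of the maximum, in
  the form of the pointwise bounds and finite sums that the estimate consumes.\<close>

lemma eps_bounds:
  assumes "eps lam bet m \<noteq> \<infinity>"
  obtains E where "E \<ge> 0" "eps lam bet m = ennreal E"
    "\<And>k. \<bar>k\<bar> > int m \<Longrightarrow> cmod (inverse (lam k)) \<le> E"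
    "\<And>J. finite J \<Longrightarrow> 0 \<notin> J \<Longrightarrow> (\<Sum>j\<in>J. (Gamma_max lam bet m j)\<^sup>2) \<le> E\<^sup>2"
proof
  let ?E = "enn2real (eps lam bet m)" and ?G = "\<lambda>j. (Gamma_max lam bet m j)\<^sup>2"
  show E: "eps lam bet m = ennreal ?E"
    using assms by (simp add: less_top)
  show "?E \<ge> 0"
    by simp
  show "cmod (inverse (lam k)) \<le> ?E" if "\<bar>k\<bar> > int m" for k
  proof -
    have "ennreal (cmod (inverse (lam k))) \<le> eps lam bet m"
      unfolding eps_def using that by (intro max.coboundedI1 SUP_upper) auto
    then show ?thesis
      by (subst (asm) E) simp
  qed
  show "sum ?G J \<le> ?E\<^sup>2" if J: "finite J" "0 \<notin> J" for J
  proof -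
    \<comment> \<open>Otherwise the \<open>else\<close> branch would make \<open>eps\<close>
      infinite.\<close>
    have summ: "?G summable_on {j. j \<noteq> 0}"
      using assms by (auto simp: eps_def max_def split: if_splits)
    then have "ennreal (sqrt (\<Sum>\<^sub>\<infinity>j\<in>{j. j \<noteq> 0}. ?G j)) \<le> eps lam bet m"
      unfolding eps_def by simp
    then have "sqrt (\<Sum>\<^sub>\<infinity>j\<in>{j. j \<noteq> 0}. ?G j) \<le> ?E"
      by (subst (asm) E) simp
    then have "(\<Sum>\<^sub>\<infinity>j\<in>{j. j \<noteq> 0}. ?G j) \<le> ?E\<^sup>2"
      by (rule sqrt_le_D)
    moreover have "sum ?G J \<le> (\<Sum>\<^sub>\<infinity>j\<in>{j. j \<noteq> 0}. ?G j)"
      using J by (intro finite_sum_le_infsum summ) auto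
    ultimately show ?thesis by linarith
  qed
qed

theorem theorem2p1:
  fixes lam bet :: "int \<Rightarrow> complex" and \<phi>lam \<phi>bet :: "real \<Rightarrow> real"
  assumes "\<And>k. lam k \<noteq> 0" and "\<And>k. bet k \<noteq> 0"
    and "\<phi>lam \<in> L2T" and "distrib_series (\<lambda>k. inverse (lam k)) \<phi>lam"
    and "\<phi>bet \<in> L2T" and "distrib_series (\<lambda>k. inverse (bet k)) \<phi>bet"
  shows "\<exists>c::real. c > 0 \<and>
    (\<forall>m::nat. m \<ge> 1 \<longrightarrow>
      (\<forall>f\<in>Phi_space \<phi>lam.
         ennreal (L2norm (\<lambda>x. f x - Q_op lam bet \<phi>lam \<phi>bet m f x))
           \<le> ennreal c * eps lam bet m * ennreal (Phi_norm \<phi>lam f)) \<and>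
      M_width (2 * m + 1) (U_ball \<phi>lam) \<phi>bet \<le> ennreal c * eps lam bet m)"
proof (rule exI[of _ 2], intro conjI allI impI ballI)
  fix m :: nat
  show err: "ennreal (L2norm (\<lambda>x. f x - Q_op lam bet \<phi>lam \<phi>bet m f x))
           \<le> ennreal 2 * eps lam bet m * ennreal (Phi_norm \<phi>lam f)"
    if "f \<in> Phi_space \<phi>lam" for f
  proof -
    define g where "g = deconv \<phi>lam f"
    define h where "h = (\<lambda>x. f x - Q_op lam bet \<phi>lam \<phi>bet m f x)"
    have f: "f \<in> L2T" and "\<exists>g. g \<in> L2T \<and> (AE x in lborel. f x = conv \<phi>lam g x)"
      using that by (auto simp: Phi_space_def)
    \<comment> \<open>Membership in \<open>Phi_space\<close> ensures that the \<open>SOME\<close> in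
      \<open>deconv\<close> returns a genuine deconvolution.\<close>
    from someI_ex[OF this(2)] have g: "g \<in> L2T" "AE x in lborel. f x = conv \<phi>lam g x"
      unfolding g_def deconv_def by blast+
    have H: "complex_of_real (H_poly lam bet m x) =
        (\<Sum>k\<in>{- int m..int m}. alpha lam bet k * cexp k x)" for x
      unfolding cexp_def by (rule of_real_H_poly[OF assms(4,6)])
    have Q: "Q_op lam bet \<phi>lam \<phi>bet m f \<in> L2T"
      by (rule Q_op_L2T[OF assms(5)])
    have h: "h \<in> L2T"
      unfolding h_def by (rule L2T_diff[OF f Q])
    let ?f = "fourier_coeff g"
    have h_coeff: "fourier_coeff h k = inverse (lam k) * ?f k - gamma_coeff lam bet m k * ?f (kprime m k)"
      for k
      unfolding h_def fourier_coeff_diff[OF f Q] fourier_coeff_conv[OF f assms(3) g]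
        fourier_coeff_distrib_series[OF assms(4)]
      using fourier_coeff_Q_op[OF H assms(5) fourier_coeff_distrib_series[OF assms(6)]] g(1)
      unfolding g_def by simp
    have norm_g: "Phi_norm \<phi>lam f = L2norm g"
      by (simp add: Phi_norm_def g_def)
    show ?thesis
    proof (cases "L2norm g = 0")
      case True
      \<comment> \<open>Not covered by the general estimate: for \<open>eps = \<infinity>\<close> the right-hand side is \<open>\<infinity> * 0 = 0\<close>.\<close>
      have "?f k = 0" for k
        using Bessel_inequality[OF g(1), of "{k}"] True by simp
      then have "(L2norm h)\<^sup>2 \<le> 0"
        by (intro L2norm_le_of_fourier_sums h) (simp add: h_coeff)
      then show ?thesis
        unfolding h_def[symmetric] by simp
    next
      case False
      then have norm_pos: "L2norm g > 0"
        using L2norm_nonneg[of g] by simp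
      show ?thesis
      proof (cases "eps lam bet m = \<infinity>")
        case True
        then show ?thesis
          using norm_pos by (simp add: norm_g ennreal_mult_top ennreal_top_mult)
      next
        case False
        then obtain E where E: "E \<ge> 0" "eps lam bet m = ennreal E"
            "\<And>k. \<bar>k\<bar> > int m \<Longrightarrow> cmod (inverse (lam k)) \<le> E"
            "\<And>J. finite J \<Longrightarrow> 0 \<notin> J \<Longrightarrow> (\<Sum>j\<in>J. (Gamma_max lam bet m j)\<^sup>2) \<le> E\<^sup>2"
          using eps_bounds by blast
        have "(\<Sum>k\<in>A. (cmod (fourier_coeff h k))\<^sup>2) \<le> (2 * E * L2norm g)\<^sup>2" if A: "finite A" for A
        proof -
          define A' where "A' = {k \<in> A. \<bar>k\<bar> > int m}"
          have A': "finite A'" "\<And>k. k \<in> A' \<Longrightarrow> \<bar>k\<bar> > int m"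
            using A by (auto simp: A'_def)
          have low: "fourier_coeff h k = 0" if "\<bar>k\<bar> \<le> int m" for k
            using assms(2) by (simp add: h_coeff kprime_id[OF that] gamma_coeff_def alpha_def field_simps)
          have "(\<Sum>k\<in>A. (cmod (fourier_coeff h k))\<^sup>2) = (\<Sum>k\<in>A'. (cmod (fourier_coeff h k))\<^sup>2)"
            using A low by (intro sum.mono_neutral_right) (auto simp: A'_def not_less)
          also have "\<dots> \<le> (\<Sum>k\<in>A'. 2 * E\<^sup>2 * (cmod (?f k))\<^sup>2 +
              2 * ((Gamma_max lam bet m (block_index m k))\<^sup>2 * (cmod (?f (kprime m k)))\<^sup>2))"
          proof (intro sum_mono)
            fix k assume k: "k \<in> A'"
            have "cmod (fourier_coeff h k) \<le> E * cmod (?f k) +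
                Gamma_max lam bet m (block_index m k) * cmod (?f (kprime m k))"
              unfolding h_coeff using E(3)[OF A'(2)[OF k]] gamma_le_Gamma[of lam bet m k]
              by (intro order_trans[OF norm_triangle_ineq4] add_mono)
                (simp_all only: norm_mult mult_right_mono norm_ge_zero)
            then have "(cmod (fourier_coeff h k))\<^sup>2 \<le> (E * cmod (?f k) +
                Gamma_max lam bet m (block_index m k) * cmod (?f (kprime m k)))\<^sup>2"
              by (intro power_mono) auto
            also note power2_add_le
            finally show "(cmod (fourier_coeff h k))\<^sup>2 \<le> 2 * E\<^sup>2 * (cmod (?f k))\<^sup>2 +
              2 * ((Gamma_max lam bet m (block_index m k))\<^sup>2 * (cmod (?f (kprime m k)))\<^sup>2)"
              by (simp add: power_mult_distrib)
          qed
          also have "\<dots> = 2 * E\<^sup>2 * (\<Sum>k\<in>A'. (cmod (?f k))\<^sup>2) +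
              2 * (\<Sum>k\<in>A'. (Gamma_max lam bet m (block_index m k))\<^sup>2 * (cmod (?f (kprime m k)))\<^sup>2)"
            by (simp add: sum.distrib sum_distrib_left)
          also have "\<dots> \<le> 2 * E\<^sup>2 * (L2norm g)\<^sup>2 + 2 * (E\<^sup>2 * (L2norm g)\<^sup>2)"
          proof (intro add_mono mult_left_mono)
            show "(\<Sum>k\<in>A'. (cmod (?f k))\<^sup>2) \<le> (L2norm g)\<^sup>2"
              by (rule Bessel_inequality[OF g(1) A'(1)])
            show "(\<Sum>k\<in>A'. (Gamma_max lam bet m (block_index m k))\<^sup>2 * (cmod (?f (kprime m k)))\<^sup>2)
                \<le> E\<^sup>2 * (L2norm g)\<^sup>2"
              by (rule sum_over_blocks[where a = "\<lambda>j. (Gamma_max lam bet m j)\<^sup>2"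
                    and b = "\<lambda>n. (cmod (?f n))\<^sup>2", OF A'])
                (auto intro!: E(4) Bessel_inequality[OF g(1)])
          qed auto
          \<comment> \<open>The high frequencies of \<open>g\<close> and the aliased ones contribute
            the factor \<open>2 * E\<^sup>2\<close> each; the root of their sum gives the constant
            2.\<close>
          also have "\<dots> = (2 * E * L2norm g)\<^sup>2"
            by (simp add: power_mult_distrib)
          finally show ?thesis .
        qed
        then have "(L2norm h)\<^sup>2 \<le> (2 * E * L2norm g)\<^sup>2"
          by (rule L2norm_le_of_fourier_sums[OF h])
        then have "L2norm h \<le> 2 * E * L2norm g"
          using E(1) norm_pos by (intro power2_le_imp_le[of "L2norm h"]) auto
        then have "ennreal (L2norm h) \<le> ennreal (2 * E * L2norm g)"
          by (rule ennreal_leI)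
        then show ?thesis
          using E(1) norm_pos unfolding h_def[symmetric] norm_g E(2)
          by (simp add: ennreal_mult)
      qed
    qed
  qed
  show "M_width (2 * m + 1) (U_ball \<phi>lam) \<phi>bet \<le> ennreal 2 * eps lam bet m"
    unfolding M_width_def
  proof (rule SUP_least)
    fix f assume "f \<in> U_ball \<phi>lam"
    then have f: "f \<in> Phi_space \<phi>lam" "Phi_norm \<phi>lam f \<le> 1"
      by (auto simp: U_ball_def)
    \<comment> \<open>The width numbers its terms from 1 and the nodes are numbered from 0, hence
      \<open>l - 1\<close>; the averaging factor moves into the coefficients.\<close>
    define c where "c l = V_op lam bet m (deconv \<phi>lam f) (delta m * real (l - 1)) / (2 * real m + 1)"
      for l
    define y where "y l = delta m * real (l - 1)" for l
    have y: "\<forall>l\<in>{1..2 * m + 1}. y l \<in> {0..2 * pi}"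
      unfolding y_def by (intro ballI delta_range) auto
    have "Q_op lam bet \<phi>lam \<phi>bet m f x = (\<Sum>l\<in>{1..2 * m + 1}. c l * \<phi>bet (x - y l))" for x
    proof -
      have "(\<Sum>l\<in>{1..2 * m + 1}. c l * \<phi>bet (x - y l)) =
          (\<Sum>l\<in>{0..2 * m}. c (Suc l) * \<phi>bet (x - y (Suc l)))"
        using sum.shift_bounds_cl_Suc_ivl[of "\<lambda>l. c l * \<phi>bet (x - y l)" 0 "2 * m"] by simp
      then show ?thesis
        by (simp add: Q_op_def c_def y_def sum_divide_distrib)
    qed
    then have "(INF (c, y)\<in>{(c, y). \<forall>l\<in>{1..2 * m + 1}. y l \<in> {0..2 * pi}}.
        ennreal (L2norm (\<lambda>x. f x - (\<Sum>l\<in>{1..2 * m + 1}. c l * \<phi>bet (x - y l)))))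
        \<le> ennreal (L2norm (\<lambda>x. f x - Q_op lam bet \<phi>lam \<phi>bet m f x))"
      using y by (intro INF_lower2[of "(c, y)"]) auto
    also have "\<dots> \<le> ennreal 2 * eps lam bet m * ennreal (Phi_norm \<phi>lam f)"
      by (rule err[OF f(1)])
    also have "\<dots> \<le> ennreal 2 * eps lam bet m * ennreal 1"
      using f(2) by (intro mult_left_mono ennreal_leI) auto
    finally show "(INF (c, y)\<in>{(c, y). \<forall>l\<in>{1..2 * m + 1}. y l \<in> {0..2 * pi}}.
        ennreal (L2norm (\<lambda>x. f x - (\<Sum>l\<in>{1..2 * m + 1}. c l * \<phi>bet (x - y l)))))
        \<le> ennreal 2 * eps lam bet m"
      by simp
  qed
qed simp

end
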